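(* Let $r$ and $m$ be positive integers and let $p>7$ be a prime such that $p\nmid m$. (i) If $r=1$, then $$\sum_{\substack{l_1+l_2+\dots+l_7=mp \\ l_1,\dots,l_7\in \mathcal{P}_p}} \frac{1}{l_1 l_2\cdots l_7} \equiv -(504m+210m^3+6m^5)\, B_{p-7} \pmod{p}.$$ (ii) If $r\ge 2$, then $$\sum_{\substack{l_1+l_2+\dots+l_7=mp^r \\ l_1,\dots,l_7\in \mathcal{P}_p}} \frac{1}{l_1 l_2\cdots l_7} \equiv -\frac{7!}{10}\, m\, p^{r-1} B_{p-7} \pmod{p^r}.$$
   Context: $\mathcal{P}_p$ denotes the set of positive integers not divisible by $p$; the sums run over ordered 7-tuples. $B_k$ are the Bernoulli numbers defined by $\frac{t}{e^t-1}=\sum_{k\ge 0} B_k\frac{t^k}{k!}$. A congruence $x\equiv y \pmod{p^k}$ between rational numbers means that $x-y\in p^k\mathbb{Z}_{(p)}$, where $\mathbb{Z}_{(p)}$ is the ring of rationals with denominator prime to $p$. *)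

theory Defs
  imports Complex_Main "HOL-Computational_Algebra.Computational_Algebra"
begin

text \<open>
  The quotient below is the formal power series division of a field: numerator and denominator
  both have subdegree 1, so it is the genuine series \<open>t / (e^t - 1)\<close>.
\<close>
definition bernoulli_fps :: "rat fps" where
  "bernoulli_fps = fps_X / (fps_exp 1 - 1)"

lemma bernoulli_fps_mult: "bernoulli_fps * (fps_exp 1 - 1) = fps_X"
proof -
  have nz: "fps_nth (fps_exp 1 - 1 :: rat fps) 1 \<noteq> 0"
    by simp
  have "fps_nth (fps_exp 1 - 1 :: rat fps) 0 = 0"
    by simp
  with nz have "subdegree (fps_exp 1 - 1 :: rat fps) = 1"
    by (intro subdegreeI) auto
  moreover from nz have "(fps_exp 1 - 1 :: rat fps) \<noteq> 0"
    by (metis fps_zero_nth)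
  ultimately have "(fps_exp 1 - 1 :: rat fps) dvd fps_X"
    by (simp add: fps_dvd_iff)
  then show ?thesis
    unfolding bernoulli_fps_def by (rule dvd_div_mult_self)
qed

text \<open>The generating function is exponential, hence the factor \<open>k!\<close>; so \<open>B\<^sub>1 = -1/2\<close>.\<close>
definition bernoulli :: "nat \<Rightarrow> rat" where
  "bernoulli k = fact k * fps_nth bernoulli_fps k"

text \<open>\<open>quotient_of\<close> returns the fraction in lowest terms with positive denominator.\<close>
definition localized_ints :: "nat \<Rightarrow> rat set" where
  "localized_ints p = {x. coprime (snd (quotient_of x)) (int p)}"

definition rat_cong :: "nat \<Rightarrow> nat \<Rightarrow> rat \<Rightarrow> rat \<Rightarrow> bool" where
  "rat_cong p k x y \<longleftrightarrow> (\<exists>z \<in> localized_ints p. x - y = of_nat p ^ k * z)"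

definition nondivisible :: "nat \<Rightarrow> nat set" where
  "nondivisible p = {l. l > 0 \<and> \<not> p dvd l}"

text \<open>Ordered \<open>k\<close>-tuples are represented as lists of length \<open>k\<close>.\<close>
definition tuples :: "nat \<Rightarrow> nat \<Rightarrow> nat \<Rightarrow> nat list set" where
  "tuples k p n = {ls. length ls = k \<and> set ls \<subseteq> nondivisible p \<and> sum_list ls = n}"

lemma finite_tuples: "finite (tuples k p n)"
proof (rule finite_subset)
  show "tuples k p n \<subseteq> {ls. set ls \<subseteq> {..n} \<and> length ls = k}"
    using member_le_sum_list by (fastforce simp: tuples_def)
  show "finite {ls. set ls \<subseteq> {..n} \<and> length ls = k}"
    by (rule finite_lists_length_eq) simp
qed

definition multiple_harmonic_sum :: "nat \<Rightarrow> nat \<Rightarrow> nat \<Rightarrow> rat" where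
  "multiple_harmonic_sum k p n = (\<Sum>ls \<in> tuples k p n. 1 / of_nat (prod_list ls))"

end

theory Submission
  imports Defs "HOL-Number_Theory.Number_Theory"
begin

text \<open>
  Put \<open>F = \<Sum> x\<^sup>l / l\<close>, summed over the \<open>l\<close> prime to \<open>p\<close>. The sum \<open>S(N)\<close> over seven-tuples with total
  \<open>N\<close> is the coefficient of \<open>x\<^sup>N\<close> in \<open>F\<^sup>7\<close>. A single polynomial governs all the cases: with
  \<open>\<phi>(M) = -(504 M + 210 M\<^sup>3 + 6 M\<^sup>5) B\<close> and \<open>B\<close> the Bernoulli number of index \<open>p - 7\<close>,
  \<open>S(M p\<^sup>r)\<close> is congruent to \<open>\<phi>(p\<^bsup>r-1\<^esup> M)\<close> modulo \<open>p\<^sup>r\<close> for every \<open>r \<ge> 1\<close> and every \<open>M\<close>. For \<open>r = 1\<close>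
  this is the first claim. For \<open>r \<ge> 2\<close> the cube and the fifth power of \<open>p\<^bsup>r-1\<^esup> M\<close> vanish modulo \<open>p\<^sup>r\<close>,
  and \<open>504 = 7!/10\<close>.

  The congruence is proved by induction on \<open>r\<close>. Let \<open>q = p\<^sup>r\<close> and write each entry as \<open>l = q a + c\<close> with
  \<open>0 < c < q\<close>. The residues \<open>c\<close> of a tuple add up to \<open>t q\<close> with \<open>1 \<le> t \<le> 6\<close>; let \<open>T\<^sub>t\<close>, the layer \<open>t\<close>,
  be the sum of \<open>1 / (c\<^sub>1 \<dots> c\<^sub>7)\<close> over all seven residues prime to \<open>p\<close> with that total. The quotients \<open>a\<close> can then be
  chosen in \<open>(M + 6 - t) choose 6\<close> ways, so \<open>S(M q)\<close> is the sum of the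
  \<open>T\<^sub>t ((M + 6 - t) choose 6)\<close>, up to a term that carries a factor \<open>q ((M + 6 - t) choose 7)\<close> and
  up to multiples of \<open>q\<^sup>2\<close> (\<open>harmonic_sum_expansion\<close>). Two facts make this a lift
  from \<open>q\<close> to \<open>p q\<close>. The layers are determined modulo \<open>q\<close> by \<open>S(q), \<dots>, S(6 q)\<close>, because the system
  is triangular (\<open>layers_from_harmonic_sum\<close>). And if \<open>p\<close> divides \<open>M\<close> then \<open>p\<close> divides all these
  binomial coefficients, as \<open>M\<close> is one of the factors of their numerators; so layers known modulo
  \<open>q\<close> give \<open>S(M q)\<close> modulo \<open>p q\<close> (\<open>harmonic_sum_from_layers\<close>).

  For \<open>q = p\<close> the layers have to be computed modulo \<open>p\<close>. There \<open>\<Sum> x\<^sup>c / c\<close> over \<open>0 < c < p\<close> is the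
  reduction of \<open>(1 - x\<^sup>p - (1 - x)\<^sup>p) / p\<close>, so \<open>p\<^sup>7 T\<^sub>t\<close> is, modulo \<open>p\<^sup>8\<close>, a coefficient of
  \<open>(1 - x\<^sup>p - (1 - x)\<^sup>p)\<^sup>7\<close>. Up to a constant this is a mixed finite difference, of order \<open>7 - t\<close> in
  \<open>i\<close> and \<open>t\<close> in \<open>j\<close>, of the quotient of \<open>p (i + j) choose p j\<close> by \<open>(i + j) choose j\<close>. These quotients
  are products and quotients of the numbers \<open>\<Prod>(1 + p a / l)\<close> over \<open>0 < l < p\<close>. Let \<open>e\<^sub>k\<close> be the
  coefficient of \<open>(p a)\<^sup>k\<close> in the latter. It is divisible by \<open>p\<close> for \<open>1 \<le> k \<le> 8\<close> and by \<open>p\<^sup>2\<close> for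
  \<open>k = 1, 3, 5\<close>, and thus modulo \<open>p\<^sup>8\<close> a difference of total order seven sees \<open>e\<^sub>6\<close> only
  (\<open>layer_coeff_cong\<close>). Finally \<open>7 e\<^sub>6\<close> is congruent to \<open>-p B\<close> modulo \<open>p\<^sup>2\<close> by Newton's identities and
  Bernoulli's formula for power sums (\<open>block_expansion\<close>).
\<close>

section \<open>The ideals generated by powers of p in the local ring\<close>

text \<open>
  The set \<open>p\<^sup>k \<int>\<^sub>(\<^sub>p\<^sub>)\<close>, so that \<open>rat_cong p k\<close> is congruence modulo an additive subgroup that is also
  closed under multiplication by the local ring. Inside the locale below it is written \<open>I k\<close>, and
  \<open>I 0\<close> is the local ring itself.
\<close>
definition pideal :: "nat \<Rightarrow> nat \<Rightarrow> rat set" where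
  "pideal p k = {x. \<exists>z \<in> localized_ints p. x = of_nat p ^ k * z}"

lemma rat_cong_iff: "rat_cong p k x y \<longleftrightarrow> x - y \<in> pideal p k"
  by (simp add: rat_cong_def pideal_def)

lemma localized_ints_iff:
  assumes "prime p"
  shows "x \<in> localized_ints p \<longleftrightarrow>
    (\<exists>a b. x = of_int a / of_int b \<and> b \<noteq> 0 \<and> \<not> int p dvd b)"
proof
  assume x: "x \<in> localized_ints p"
  obtain a b where ab: "quotient_of x = (a, b)" by force
  with x have "coprime b (int p)" by (simp add: localized_ints_def)
  then have "\<not> int p dvd b"
    using assms by (metis coprime_absorb_right not_prime_unit prime_nat_int_transfer)
  moreover have "b \<noteq> 0" using quotient_of_denom_pos[OF ab] by simp
  ultimately show "\<exists>a b. x = of_int a / of_int b \<and> b \<noteq> 0 \<and> \<not> int p dvd b"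
    using quotient_of_div[OF ab] by blast
next
  assume "\<exists>a b. x = of_int a / of_int b \<and> b \<noteq> 0 \<and> \<not> int p dvd b"
  then obtain a b where x: "x = of_int a / of_int b" and b: "b \<noteq> 0" "\<not> int p dvd b" by blast
  obtain c d where cd: "quotient_of x = (c, d)" by force
  then have d: "x = of_int c / of_int d" "d > 0" "coprime c d"
    using quotient_of_div quotient_of_denom_pos quotient_of_coprime by auto
  have "(of_int (a * d) :: rat) = of_int (c * b)"
    using x d b by (simp add: field_simps)
  then have "a * d = c * b" by (simp only: of_int_eq_iff)
  then have "d dvd b"
    using d(3) by (metis coprime_commute coprime_dvd_mult_right_iff dvd_triv_right)
  then have "\<not> int p dvd d" using b(2) dvd_trans by blast
  then have "coprime (int p) d"
    using assms by (simp add: prime_imp_coprime)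
  then show "x \<in> localized_ints p"
    using cd by (simp add: localized_ints_def coprime_commute)
qed

locale prime_local =
  fixes p :: nat
  assumes prime_p: "prime p"
begin

lemma p_pos: "p > 0"
  using prime_p by (simp add: prime_gt_0_nat)

lemma localized_of_int: "of_int a \<in> localized_ints p"
  using prime_p unfolding localized_ints_iff[OF prime_p]
  by (intro exI[of _ a] exI[of _ "1::int"]) (auto simp: prime_nat_iff)

lemma localized_add: "x \<in> localized_ints p \<Longrightarrow> y \<in> localized_ints p \<Longrightarrow> x + y \<in> localized_ints p"
  unfolding localized_ints_iff[OF prime_p]
proof (elim exE conjE)
  fix a b c d
  assume *: "x = of_int a / of_int b" "b \<noteq> 0" "\<not> int p dvd b"
    "y = of_int c / of_int d" "d \<noteq> 0" "\<not> int p dvd d"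
  then have "x + y = of_int (a * d + c * b) / of_int (b * d)" by (simp add: field_simps)
  moreover have "\<not> int p dvd b * d"
    using * prime_p by (simp add: prime_dvd_mult_iff)
  ultimately show "\<exists>a b. x + y = of_int a / of_int b \<and> b \<noteq> 0 \<and> \<not> int p dvd b"
    using * by (metis mult_eq_0_iff)
qed

lemma localized_mult: "x \<in> localized_ints p \<Longrightarrow> y \<in> localized_ints p \<Longrightarrow> x * y \<in> localized_ints p"
  unfolding localized_ints_iff[OF prime_p]
proof (elim exE conjE)
  fix a b c d
  assume *: "x = of_int a / of_int b" "b \<noteq> 0" "\<not> int p dvd b"
    "y = of_int c / of_int d" "d \<noteq> 0" "\<not> int p dvd d"
  then have "x * y = of_int (a * c) / of_int (b * d)" by (simp add: field_simps)
  moreover have "\<not> int p dvd b * d"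
    using * prime_p by (simp add: prime_dvd_mult_iff)
  ultimately show "\<exists>a b. x * y = of_int a / of_int b \<and> b \<noteq> 0 \<and> \<not> int p dvd b"
    using * by (metis mult_eq_0_iff)
qed

abbreviation I :: "nat \<Rightarrow> rat set" where "I \<equiv> pideal p"

lemma I_0: "I 0 = localized_ints p"
  by (auto simp: pideal_def)

lemma I_of_int [simp]: "of_int a \<in> I 0"
  using localized_of_int by (simp add: I_0)

lemma I_of_nat [simp]: "of_nat a \<in> I 0"
  using I_of_int[of "int a"] by simp

lemma I_numeral [simp]: "numeral a \<in> I 0"
  using I_of_int[of "numeral a"] by simp

lemma I_one [simp]: "1 \<in> I 0"
  using I_of_int[of 1] by simp

lemma I_zero [simp]: "0 \<in> I k"
  using localized_of_int[of 0] by (auto simp: pideal_def)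

lemma I_inverse_of_nat:
  assumes "\<not> p dvd n"
  shows "1 / of_nat n \<in> I 0"
proof -
  have "n \<noteq> 0" using assms by (rule contrapos_nn) simp
  then show ?thesis
    unfolding I_0 localized_ints_iff[OF prime_p]
    using assms by (intro exI[of _ 1] exI[of _ "int n"]) simp
qed

lemma I_add [intro]: "x \<in> I k \<Longrightarrow> y \<in> I k \<Longrightarrow> x + y \<in> I k"
  by (auto simp: pideal_def simp flip: distrib_left intro!: localized_add)

lemma I_mult: "x \<in> I k \<Longrightarrow> y \<in> I l \<Longrightarrow> x * y \<in> I (k + l)"
proof -
  assume "x \<in> I k" "y \<in> I l"
  then obtain a b where "a \<in> localized_ints p" "b \<in> localized_ints p"
    "x = of_nat p ^ k * a" "y = of_nat p ^ l * b" by (auto simp: pideal_def)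
  then show ?thesis
    unfolding pideal_def by (intro CollectI bexI[of _ "a * b"]) (auto simp: power_add localized_mult)
qed

lemma I_mult_left [intro]: "x \<in> I 0 \<Longrightarrow> y \<in> I k \<Longrightarrow> x * y \<in> I k"
  using I_mult[of x 0 y k] by simp

lemma I_mult_right: "x \<in> I k \<Longrightarrow> y \<in> I 0 \<Longrightarrow> x * y \<in> I k"
  using I_mult[of x k y 0] by simp

lemma I_uminus [intro]: "x \<in> I k \<Longrightarrow> - x \<in> I k"
  using I_mult_left[OF I_of_int[of "-1"], of x k] by simp

lemma I_diff [intro]: "x \<in> I k \<Longrightarrow> y \<in> I k \<Longrightarrow> x - y \<in> I k"
  using I_add[of x k "- y"] I_uminus[of y k] by simp

lemma I_power [intro]: "x \<in> I 0 \<Longrightarrow> x ^ n \<in> I 0"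
  by (induction n) auto

lemma I_p_power: "of_nat p ^ k \<in> I k"
  using localized_of_int[of 1] by (auto simp: pideal_def)

lemma I_p_power_mult: "x \<in> I l \<Longrightarrow> of_nat p ^ k * x \<in> I (k + l)"
  by (intro I_mult I_p_power)

lemma I_p_power_mult_iff: "of_nat p ^ k * x \<in> I (k + l) \<longleftrightarrow> x \<in> I l"
proof
  assume "of_nat p ^ k * x \<in> I (k + l)"
  then obtain z where z: "z \<in> localized_ints p" "of_nat p ^ k * x = of_nat p ^ (k + l) * z"
    unfolding pideal_def by blast
  have "of_nat p ^ k * x = of_nat p ^ k * (of_nat p ^ l * z)"
    using z(2) by (simp only: power_add mult.assoc)
  moreover have "of_nat p ^ k \<noteq> (0 :: rat)"
    using p_pos by simp
  ultimately have "x = of_nat p ^ l * z"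
    by (simp only: mult_cancel_left) blast
  then show "x \<in> I l"
    using z(1) unfolding pideal_def by blast
qed (rule I_p_power_mult)

lemma I_obtain:
  assumes "x \<in> I k"
  obtains z where "z \<in> I 0" "x = of_nat p ^ k * z"
proof -
  obtain z where "z \<in> localized_ints p" "x = of_nat p ^ k * z"
    using assms by (auto simp: pideal_def)
  then show ?thesis
    using that[of z] by (simp add: I_0)
qed

lemma I_mono: "x \<in> I k \<Longrightarrow> l \<le> k \<Longrightarrow> x \<in> I l"
proof -
  assume x: "x \<in> I k" and l: "l \<le> k"
  obtain z where "z \<in> I 0" "x = of_nat p ^ k * z" using I_obtain[OF x] .
  then have "x = of_nat p ^ l * (of_nat p ^ (k - l) * z)"
    using l by (simp flip: power_add mult.assoc)
  moreover have "of_nat p ^ (k - l) * z \<in> I 0"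
    using \<open>z \<in> I 0\<close> by (intro I_mult_left I_power) auto
  ultimately have "x \<in> I (l + 0)"
    using I_mult[OF I_p_power, of "of_nat p ^ (k - l) * z" 0 l] by simp
  then show ?thesis by simp
qed

lemma I_sum: "(\<And>i. i \<in> A \<Longrightarrow> f i \<in> I k) \<Longrightarrow> sum f A \<in> I k"
  by (induction A rule: infinite_finite_induct) auto

text \<open>
  An integer prime to \<open>p\<close> is a unit of the local ring.
\<close>
lemma I_cancel:
  assumes "of_nat n * x \<in> I k" "\<not> p dvd n"
  shows "x \<in> I k"
proof -
  have "n \<noteq> 0" using assms(2) by (metis dvd_0_right)
  then have "1 / of_nat n * (of_nat n * x) = x" by (simp add: field_simps)
  then show ?thesis
    using I_mult_left[OF I_inverse_of_nat[OF assms(2)] assms(1)] by (simp only:)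
qed

lemma I_of_nat_dvd: "p ^ k dvd n \<Longrightarrow> of_nat n \<in> I k"
  by (auto simp: elim!: dvdE intro!: I_mult_right I_p_power)

lemma I_of_int_dvd: "int p ^ k dvd n \<Longrightarrow> of_int n \<in> I k"
  by (auto simp: elim!: dvdE intro!: I_mult_right I_p_power)

lemma I_trans: "x - y \<in> I k \<Longrightarrow> y - z \<in> I k \<Longrightarrow> x - z \<in> I k"
  using I_add[of "x - y" k "y - z"] by simp

lemma I_cong: "x - y \<in> I k \<Longrightarrow> x \<in> I k \<longleftrightarrow> y \<in> I k"
  using I_add[of "x - y" k y] I_diff[of x k "x - y"] by auto

section \<open>Formal power series with coefficients in the local ring\<close>

text \<open>
  The analogue of \<open>I k\<close> for series: a congruence modulo \<open>J k\<close> is a coefficientwise congruence modulo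
  \<open>p\<^sup>k\<close>.
\<close>
definition J :: "nat \<Rightarrow> rat fps set" where
  "J k = {f. \<forall>n. fps_nth f n \<in> I k}"

lemma J_nth: "f \<in> J k \<Longrightarrow> fps_nth f n \<in> I k"
  by (simp add: J_def)

lemma J_add: "f \<in> J k \<Longrightarrow> g \<in> J k \<Longrightarrow> f + g \<in> J k"
  by (auto simp: J_def)

lemma J_diff: "f \<in> J k \<Longrightarrow> g \<in> J k \<Longrightarrow> f - g \<in> J k"
  by (auto simp: J_def)

lemma J_mult: "f \<in> J k \<Longrightarrow> g \<in> J l \<Longrightarrow> f * g \<in> J (k + l)"
  by (auto simp: J_def fps_mult_nth intro!: I_sum I_mult)

lemma J_mult_left: "f \<in> J 0 \<Longrightarrow> g \<in> J k \<Longrightarrow> f * g \<in> J k"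
  using J_mult[of f 0 g k] by simp

lemma J_mult_right: "f \<in> J k \<Longrightarrow> g \<in> J 0 \<Longrightarrow> f * g \<in> J k"
  using J_mult[of f k g 0] by simp

lemma J_one: "1 \<in> J 0"
  by (auto simp: J_def)

lemma J_X_power: "fps_X ^ n \<in> J 0"
  by (auto simp: J_def)

lemma J_power: "f \<in> J 0 \<Longrightarrow> f ^ n \<in> J 0"
  by (induction n) (auto intro: J_one J_mult_left)

lemma J_power_cong:
  assumes "f \<in> J 0" "g \<in> J 0" "f - g \<in> J k"
  shows "f ^ n - g ^ n \<in> J k"
proof (induction n)
  case 0
  show ?case by (simp add: J_def)
next
  case (Suc n)
  have "f ^ Suc n - g ^ Suc n = f * (f ^ n - g ^ n) + (f - g) * g ^ n"
    by (simp add: algebra_simps)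
  moreover have "f * (f ^ n - g ^ n) + (f - g) * g ^ n \<in> J k"
    using Suc assms by (intro J_add J_mult_left[of f] J_mult_right J_power)
  ultimately show ?case by simp
qed

end

section \<open>Multiple harmonic sums as coefficients\<close>

definition harmonic_fps :: "nat \<Rightarrow> rat fps" where
  "harmonic_fps p = Abs_fps (\<lambda>n. if p dvd n then 0 else 1 / of_nat n)"

text \<open>
  Splitting off the first entry of a tuple is one step of a Cauchy product.
\<close>
lemma multiple_harmonic_sum_Suc:
  "multiple_harmonic_sum (Suc k) p n =
    (\<Sum>l = 0..n. fps_nth (harmonic_fps p) l * multiple_harmonic_sum k p (n - l))"
proof -
  define L where "L = {l. l \<le> n \<and> \<not> p dvd l}"
  have fin: "finite L" by (simp add: L_def)
  have "bij_betw (\<lambda>(l, ls). l # ls) (SIGMA l:L. tuples k p (n - l)) (tuples (Suc k) p n)"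
    unfolding bij_betw_def
  proof
    show "inj_on (\<lambda>(l, ls). l # ls) (SIGMA l:L. tuples k p (n - l))"
      by (auto simp: inj_on_def)
    show "(\<lambda>(l, ls). l # ls) ` (SIGMA l:L. tuples k p (n - l)) = tuples (Suc k) p n"
    proof
      show "(\<lambda>(l, ls). l # ls) ` (SIGMA l:L. tuples k p (n - l)) \<subseteq> tuples (Suc k) p n"
        by (auto simp: tuples_def L_def nondivisible_def intro: Nat.gr0I)
      show "tuples (Suc k) p n \<subseteq> (\<lambda>(l, ls). l # ls) ` (SIGMA l:L. tuples k p (n - l))"
      proof
        fix xs assume xs: "xs \<in> tuples (Suc k) p n"
        then obtain l ls where [simp]: "xs = l # ls"
          by (auto simp: tuples_def length_Suc_conv)
        from xs have "(l, ls) \<in> (SIGMA l:L. tuples k p (n - l))"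
          by (auto simp: tuples_def L_def nondivisible_def)
        then show "xs \<in> (\<lambda>(l, ls). l # ls) ` (SIGMA l:L. tuples k p (n - l))"
          by (intro rev_image_eqI[of "(l, ls)"]) auto
      qed
    qed
  qed
  then have "multiple_harmonic_sum (Suc k) p n =
      (\<Sum>(l, ls) \<in> (SIGMA l:L. tuples k p (n - l)). 1 / of_nat (prod_list (l # ls)))"
    unfolding multiple_harmonic_sum_def
    by (subst sum.reindex_bij_betw[symmetric]) (auto intro!: sum.cong)
  also have "\<dots> = (\<Sum>l\<in>L. \<Sum>ls\<in>tuples k p (n - l). 1 / of_nat (prod_list (l # ls)))"
    using fin by (subst sum.Sigma) (auto simp: finite_tuples)
  also have "\<dots> = (\<Sum>l\<in>L. fps_nth (harmonic_fps p) l * multiple_harmonic_sum k p (n - l))"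
    by (auto simp: multiple_harmonic_sum_def sum_distrib_left harmonic_fps_def L_def intro!: sum.cong)
  also have "\<dots> = (\<Sum>l = 0..n. fps_nth (harmonic_fps p) l * multiple_harmonic_sum k p (n - l))"
    by (rule sum.mono_neutral_left) (auto simp: L_def harmonic_fps_def)
  finally show ?thesis .
qed

lemma multiple_harmonic_sum_eq_nth:
  "multiple_harmonic_sum k p n = fps_nth (harmonic_fps p ^ k) n"
proof (induction k arbitrary: n)
  case 0
  have "tuples 0 p n = (if n = 0 then {[]} else {})"
    by (auto simp: tuples_def)
  then show ?case by (simp add: multiple_harmonic_sum_def)
next
  case (Suc k)
  then show ?case by (simp add: multiple_harmonic_sum_Suc fps_mult_nth)
qed

section \<open>Negative powers of 1 - X^q\<close>

text \<open>
  The series of \<open>(1 - x\<^sup>q)\<^bsup>-(k+1)\<^esup>\<close>.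
\<close>
definition binomial_fps :: "nat \<Rightarrow> nat \<Rightarrow> rat fps" where
  "binomial_fps q k = Abs_fps (\<lambda>n. if q dvd n then of_nat ((n div q + k) choose k) else 0)"

lemma binomial_fps_0:
  assumes "q > 0"
  shows "(1 - fps_X ^ q) * binomial_fps q 0 = 1"
  using assms
  by (auto simp: fps_eq_iff ring_distribs fps_X_power_mult_nth binomial_fps_def dvd_minus_self)

lemma binomial_fps_Suc:
  assumes "q > 0"
  shows "(1 - fps_X ^ q) * binomial_fps q (Suc k) = binomial_fps q k"
proof (rule fps_ext)
  fix n
  show "fps_nth ((1 - fps_X ^ q) * binomial_fps q (Suc k)) n = fps_nth (binomial_fps q k) n"
  proof (cases "n < q")
    case True
    then show ?thesis
      using assms
      by (auto simp: ring_distribs fps_X_power_mult_nth binomial_fps_def dest: dvd_imp_le)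
  next
    case False
    then have "(n - q) div q = n div q - 1" "n div q > 0"
      using assms by (auto simp: le_div_geq div_greater_zero_iff)
    then have "n div q + Suc k = Suc ((n - q) div q + Suc k)" "n div q + k = (n - q) div q + Suc k"
      by auto
    then show ?thesis
      using False assms
      by (auto simp: ring_distribs fps_X_power_mult_nth binomial_fps_def dvd_minus_self)
  qed
qed

lemma binomial_fps_power:
  assumes "q > 0"
  shows "(1 - fps_X ^ q) ^ Suc k * binomial_fps q k = 1"
proof (induction k)
  case (Suc k)
  have "(1 - fps_X ^ q) ^ Suc (Suc k) * binomial_fps q (Suc k)
      = (1 - fps_X ^ q) ^ Suc k * ((1 - fps_X ^ q) * binomial_fps q (Suc k))"
    by (simp only: power_Suc ac_simps)
  then show ?case using Suc by (simp only: binomial_fps_Suc[OF assms])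
qed (simp add: binomial_fps_0[OF assms])

lemma fps_shifted_binomial_fps_nth:
  assumes "q > 0"
  shows "fps_nth (fps_X ^ q * binomial_fps q (Suc k)) (a * q) = of_nat ((a + k) choose Suc k)"
proof (cases a)
  case (Suc b)
  then have "fps_nth (fps_X ^ q * binomial_fps q (Suc k)) (a * q)
      = of_nat ((b + Suc k) choose Suc k)"
    using assms by (simp add: fps_X_power_mult_nth binomial_fps_def)
  then show ?thesis using Suc by simp
qed (use assms in \<open>simp add: fps_X_power_mult_nth\<close>)

text \<open>
  Only coefficients of \<open>u\<close> at multiples of \<open>q\<close> meet the support of \<open>w\<close>, and only six of them are nonzero.
  The sum can run over \<open>1 \<le> t \<le> 6\<close> even if \<open>M < t\<close>: then \<open>M + 6 - t < 6 \<le> k\<close>, and the binomial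
  coefficient vanishes.
\<close>
lemma nth_mult_supported_on_multiples:
  assumes q: "q > 0"
    and w: "\<And>n. \<not> q dvd n \<Longrightarrow> fps_nth w n = 0"
    and wb: "\<And>a. fps_nth w (a * q) = of_nat ((a + 6) choose k)"
    and k: "k > 5"
    and u: "\<And>t. t = 0 \<or> t > 6 \<Longrightarrow> fps_nth u (t * q) = (0 :: rat)"
  shows "fps_nth (u * w) (M * q) = (\<Sum>t = 1..6. fps_nth u (t * q) * of_nat ((M + 6 - t) choose k))"
proof -
  have "fps_nth (u * w) (M * q) = (\<Sum>i\<in>{0..M * q}. fps_nth u i * fps_nth w (M * q - i))"
    by (simp add: fps_mult_nth)
  also have "\<dots> = (\<Sum>i\<in>(\<lambda>t. t * q) ` {0..M}. fps_nth u i * fps_nth w (M * q - i))"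
  proof (rule sum.mono_neutral_right)
    show "\<forall>i\<in>{0..M * q} - (\<lambda>t. t * q) ` {0..M}. fps_nth u i * fps_nth w (M * q - i) = 0"
    proof
      fix i assume i: "i \<in> {0..M * q} - (\<lambda>t. t * q) ` {0..M}"
      have "\<not> q dvd M * q - i"
      proof
        assume "q dvd M * q - i"
        then have "q dvd i"
          using i by (metis DiffD1 atLeastAtMost_iff dvd_diffD1 dvd_triv_right)
        then obtain t where "i = t * q" by (metis dvdE mult.commute)
        then show False using i q by auto
      qed
      then show "fps_nth u i * fps_nth w (M * q - i) = 0" using w by simp
    qed
  qed (use q in auto)
  also have "\<dots> = (\<Sum>t = 0..M. fps_nth u (t * q) * fps_nth w (M * q - t * q))"
    using q by (subst sum.reindex) (auto simp: inj_on_def)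
  also have "\<dots> = (\<Sum>t = 0..M. fps_nth u (t * q) * of_nat ((M + 6 - t) choose k))"
  proof (rule sum.cong)
    fix t assume "t \<in> {0..M}"
    then have "M * q - t * q = (M - t) * q" "M - t + 6 = M + 6 - t"
      by (auto simp: diff_mult_distrib)
    then show "fps_nth u (t * q) * fps_nth w (M * q - t * q)
        = fps_nth u (t * q) * of_nat ((M + 6 - t) choose k)"
      using wb[of "M - t"] by simp
  qed simp
  also have "\<dots> = (\<Sum>t\<in>{0..M} \<inter> {1..6}. fps_nth u (t * q) * of_nat ((M + 6 - t) choose k))"
    using u by (intro sum.mono_neutral_right) auto
  also have "\<dots> = (\<Sum>t = 1..6. fps_nth u (t * q) * of_nat ((M + 6 - t) choose k))"
    using k by (intro sum.mono_neutral_left) (auto simp: binomial_eq_0_iff)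
  finally show ?thesis .
qed

lemma fps_mult_nth_eq_0_degree:
  assumes "\<And>i. i > a \<Longrightarrow> fps_nth f i = (0 :: 'a :: comm_ring_1)" "\<And>i. i > b \<Longrightarrow> fps_nth g i = 0"
    and "n > a + b"
  shows "fps_nth (f * g) n = 0"
  unfolding fps_mult_nth
proof (rule sum.neutral, rule ballI)
  fix i assume "i \<in> {0..n}"
  then have "i > a \<or> n - i > b" using assms(3) by auto
  then show "fps_nth f i * fps_nth g (n - i) = 0" using assms(1,2) by auto
qed

lemma fps_power_nth_eq_0_degree:
  assumes "\<And>i. i > a \<Longrightarrow> fps_nth f i = (0 :: 'a :: comm_ring_1)" "n > k * a"
  shows "fps_nth (f ^ k) n = 0"
  using assms(2)
proof (induction k arbitrary: n)
  case (Suc k)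
  show ?case unfolding power_Suc
    by (rule fps_mult_nth_eq_0_degree[of a _ "k * a"]) (use assms(1) Suc in auto)
qed simp

section \<open>Harmonic sums in terms of layers\<close>

text \<open>
  The prime divides the numerator \<open>n (n - 1) \<dots> (n - k + 1)\<close>, of which \<open>n - i\<close> is a factor, but not the
  denominator \<open>k!\<close>.
\<close>
lemma prime_dvd_choose_if_dvd_factor:
  fixes p n k i :: nat
  assumes "prime p" "k < p" "i < k" "i \<le> n" "p dvd n - i"
  shows "p dvd n choose k"
proof -
  have "(\<Prod>j = 0..<k. rat_of_nat n - of_nat j) = of_int (\<Prod>j = 0..<k. int n - int j)" by simp
  then have "(of_int (fact k * int (n choose k)) :: rat) = of_int (\<Prod>j = 0..<k. int n - int j)"
    using gbinomial_mult_fact[of k "of_nat n :: rat"] by (simp add: binomial_gbinomial)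
  then have eq: "fact k * int (n choose k) = (\<Prod>j = 0..<k. int n - int j)"
    by (simp only: of_int_eq_iff)
  have "int p dvd int n - int i"
    using assms(4,5) by (metis int_dvd_int_iff of_nat_diff)
  also have "\<dots> dvd (\<Prod>j = 0..<k. int n - int j)"
    using assms(3) by (intro dvd_prodI) auto
  finally have "int p dvd int (fact k * (n choose k))"
    by (simp add: eq)
  then have "p dvd fact k * (n choose k)"
    by (simp only: int_dvd_int_iff)
  moreover have "\<not> p dvd fact k"
    using assms(1,2) by (simp add: prime_dvd_fact_iff)
  ultimately show ?thesis
    using assms(1) by (simp add: prime_dvd_mult_iff)
qed

context prime_local
begin

text \<open>
  The part of \<open>\<Sum> x\<^sup>n / n\<^sup>e\<close> that belongs to the reduced residues \<open>0 < n < q\<close>. The layer \<open>t\<close> for \<open>q\<close> is the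
  coefficient of \<open>x\<^bsup>tq\<^esup>\<close> in the seventh power of \<open>layer_fps q 1\<close>.
\<close>
definition layer_fps :: "nat \<Rightarrow> nat \<Rightarrow> rat fps" where
  "layer_fps q e = Abs_fps (\<lambda>n. if n < q \<and> \<not> p dvd n then 1 / of_nat n ^ e else 0)"

lemma I_inverse_power: "\<not> p dvd n \<Longrightarrow> 1 / of_nat n ^ e \<in> I 0"
  using I_power[OF I_inverse_of_nat, of n e] by (simp add: power_divide)

lemma layer_fps_J: "layer_fps q e \<in> J 0"
  by (auto simp: J_def layer_fps_def intro: I_inverse_power)

lemma harmonic_fps_J: "harmonic_fps p \<in> J 0"
  by (auto simp: J_def harmonic_fps_def intro: I_inverse_of_nat)

lemma binomial_fps_J: "binomial_fps q k \<in> J 0"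
  by (auto simp: J_def binomial_fps_def)

lemma one_minus_X_J: "1 - fps_X ^ q \<in> J 0"
  by (intro J_diff J_one J_X_power)

text \<open>
  For \<open>n = q a + c\<close> the expansion \<open>1/n = 1/c - q a / c\<^sup>2\<close> modulo \<open>q\<^sup>2\<close> says that \<open>F\<close> is congruent to
  \<open>f / (1 - x\<^sup>q) - q g x\<^sup>q / (1 - x\<^sup>q)\<^sup>2\<close>, where \<open>f\<close> and \<open>g\<close> are the layer series with exponents one and two.
  Clearing denominators turns this into a check of at most three
  coefficients of \<open>F\<close> at a time: a second difference of \<open>1/n\<close> with step \<open>q\<close> is a multiple of \<open>q\<^sup>2\<close>.
\<close>
lemma harmonic_fps_expansion:
  assumes q: "q = p ^ r" "r > 0"
  shows "harmonic_fps p * (1 - fps_X ^ q) ^ 2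
    - (layer_fps q 1 * (1 - fps_X ^ q) - fps_const (of_nat q) * layer_fps q 2 * fps_X ^ q) \<in> J (2 * r)"
    (is "?d \<in> _")
  unfolding J_def
proof (intro CollectI allI)
  fix n
  let ?F = "fps_nth (harmonic_fps p)"
  have q0: "q > 0" using q p_pos by simp
  have pq: "p dvd q" using q by auto
  have qI: "(of_nat q :: rat) * of_nat q \<in> I (2 * r)"
    using I_p_power[of "2 * r"] by (simp add: q(1) flip: power_add mult_2)
  have d: "fps_nth ?d n = ?F n - 2 * (if n < q then 0 else ?F (n - q))
        + (if n < 2 * q then 0 else ?F (n - 2 * q))
        - fps_nth (layer_fps q 1) n + (if n < q then 0 else fps_nth (layer_fps q 1) (n - q))
        + of_nat q * (if n < q then 0 else fps_nth (layer_fps q 2) (n - q))"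
  proof -
    have XX: "fps_X ^ (2 * q) = (fps_X ^ q * fps_X ^ q :: rat fps)"
      by (simp only: mult_2 power_add)
    have eq: "?d = harmonic_fps p - fps_const 2 * (fps_X ^ q * harmonic_fps p)
        + fps_X ^ (2 * q) * harmonic_fps p
        - layer_fps q 1 + fps_X ^ q * layer_fps q 1 + fps_const (of_nat q) * (fps_X ^ q * layer_fps q 2)"
      unfolding XX by (simp add: algebra_simps power2_eq_square fps_numeral_fps_const)
    show ?thesis
      unfolding eq by (simp add: fps_X_power_mult_nth)
  qed
  show "fps_nth ?d n \<in> I (2 * r)"
  proof (cases "p dvd n")
    case True
    have "p dvd n - q" "p dvd n - 2 * q" using True pq by (auto intro: dvd_diff_nat)
    then show ?thesis using True unfolding d by (simp add: harmonic_fps_def layer_fps_def)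
  next
    case False
    consider "n < q" | "q \<le> n" "n < 2 * q" | "2 * q \<le> n" by linarith
    then show ?thesis
    proof cases
      case 1
      then show ?thesis using False unfolding d by (simp add: harmonic_fps_def layer_fps_def)
    next
      case 2
      define c where "c = n - q"
      have n: "n = c + q" using 2 by (simp add: c_def)
      have pc: "\<not> p dvd c" using False pq n by (metis dvd_add)
      then have c0: "c \<noteq> 0" by (metis dvd_0_right)
      have cq: "c < q" using 2 n by simp
      have "fps_nth ?d n = 1 / of_nat (c + q) - 2 * (1 / of_nat c) + 1 / of_nat c + of_nat q * (1 / of_nat c ^ 2)"
        using 2 cq pc False unfolding d by (simp add: harmonic_fps_def layer_fps_def n)
      also have "\<dots> = (1 / of_nat (c + q)) * (1 / of_nat c ^ 2) * (of_nat q * of_nat q)"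
        using c0 by (simp add: divide_simps del: of_nat_add of_nat_mult) (simp add: algebra_simps power2_eq_square)
      also have "\<dots> \<in> I (2 * r)"
        using False pc n by (intro I_mult_left[OF _ qI] I_mult_left[of _ _ 0] I_inverse_of_nat I_inverse_power) auto
      finally show ?thesis .
    next
      case 3
      define c where "c = n - 2 * q"
      have n: "n = c + 2 * q" "n - q = c + q" using 3 by (auto simp: c_def)
      have pc: "\<not> p dvd c" "\<not> p dvd c + q" using False pq n by (auto simp: dvd_add_left_iff)
      then have c0: "c \<noteq> 0" by (metis dvd_0_right)
      have "fps_nth ?d n = 1 / of_nat (c + 2 * q) - 2 * (1 / of_nat (c + q)) + 1 / of_nat c"
        using 3 pc False unfolding d n(2) by (simp add: harmonic_fps_def layer_fps_def n(1))
      also have "\<dots> = 2 * ((1 / of_nat (c + 2 * q)) * (1 / of_nat (c + q)) * (1 / of_nat c) * (of_nat q * of_nat q))"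
        using c0 q0 by (simp add: divide_simps del: of_nat_add of_nat_mult) (simp add: algebra_simps power2_eq_square)
      also have "\<dots> \<in> I (2 * r)"
        using False pc n
        by (intro I_mult_left[OF I_numeral] I_mult_left[OF _ qI] I_mult_left[of _ _ 0] I_inverse_of_nat) auto
      finally show ?thesis .
    qed
  qed
qed


text \<open>
  The binomial theorem, truncated after the term linear in \<open>b\<close>.
\<close>
lemma power_minus_small:
  assumes "a \<in> J 0" "b \<in> J r"
  shows "(a - b) ^ Suc n - (a ^ Suc n - of_nat (Suc n) * a ^ n * b) \<in> J (2 * r)"
proof (induction n)
  case 0
  show ?case by (simp add: J_def)
next
  case (Suc n)
  have "(a - b) ^ Suc (Suc n) - (a ^ Suc (Suc n) - of_nat (Suc (Suc n)) * a ^ Suc n * b)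
      = (a - b) * ((a - b) ^ Suc n - (a ^ Suc n - of_nat (Suc n) * a ^ n * b))
        + of_nat (Suc n) * a ^ n * (b * b)"
    by (simp add: algebra_simps)
  moreover have "a - b \<in> J 0"
    using assms by (auto simp: J_def intro: I_mono)
  moreover have "of_nat (Suc n) * a ^ n \<in> J 0"
    using J_mult_left[of "of_nat (Suc n)" "a ^ n" 0] J_power[OF assms(1)]
    by (auto simp: J_def simp flip: fps_of_nat simp del: of_nat_Suc)
  moreover have "b * b \<in> J (2 * r)"
    using J_mult[OF assms(2) assms(2)] by (simp add: mult_2)
  ultimately show ?case
    using Suc by (auto intro!: J_add intro: J_mult_left)
qed

text \<open>
  The expansion of \<open>F\<close> raised to the seventh power, with the denominators restored.
\<close>
lemma harmonic_seventh_power: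
  assumes q: "q = p ^ r" "r > 0"
  shows "harmonic_fps p ^ 7 - (layer_fps q 1 ^ 7 * binomial_fps q 6
      - fps_const (7 * of_nat q) * (layer_fps q 1 ^ 6 * layer_fps q 2 * (fps_X ^ q * binomial_fps q 7)))
      \<in> J (2 * r)"
proof -
  define F where "F = harmonic_fps p"
  define Y where "Y = (1 - fps_X ^ q :: rat fps)"
  define f where "f = layer_fps q 1"
  define g where "g = layer_fps q 2"
  define b where "b = fps_const (of_nat q) * g * fps_X ^ q"
  have q0: "q > 0" using q p_pos by simp
  have qI: "of_nat q \<in> I r" using I_p_power[of r] q by simp
  have fJ: "f \<in> J 0" and gJ: "g \<in> J 0" and FJ: "F \<in> J 0" and YJ: "Y \<in> J 0"
    by (simp_all add: f_def g_def F_def Y_def layer_fps_J harmonic_fps_J one_minus_X_J)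
  have "fps_const (of_nat q) \<in> J r" using qI by (auto simp: J_def)
  then have bJ: "b \<in> J r"
    unfolding b_def by (intro J_mult_right gJ J_X_power)
  have fY: "f * Y \<in> J 0" by (intro J_mult_left fJ YJ)
  have FY: "F * Y ^ 2 \<in> J 0" by (intro J_mult_left FJ J_power YJ)
  have "F * Y ^ 2 - (f * Y - b) \<in> J (2 * r)"
    using harmonic_fps_expansion[OF q] unfolding F_def f_def g_def Y_def b_def by simp
  moreover have "f * Y - b \<in> J 0"
    using fY bJ by (auto simp: J_def intro: I_mono)
  ultimately have 1: "(F * Y ^ 2) ^ 7 - (f * Y - b) ^ 7 \<in> J (2 * r)"
    by (intro J_power_cong FY)
  have 2: "(f * Y - b) ^ 7 - ((f * Y) ^ 7 - 7 * (f * Y) ^ 6 * b) \<in> J (2 * r)"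
    using power_minus_small[OF fY bJ, of 6] by simp
  have 3: "(F * Y ^ 2) ^ 7 - ((f * Y) ^ 7 - 7 * (f * Y) ^ 6 * b) \<in> J (2 * r)"
    using J_add[OF 1 2] by (simp only: add_diff_eq diff_add_cancel)
  define V where "V = binomial_fps q 6"
  define W where "W = binomial_fps q 7"
  have YV: "Y ^ 7 * V = 1" and YW: "Y ^ 8 * W = 1"
    using binomial_fps_power[OF q0, of 6] binomial_fps_power[OF q0, of 7]
    by (simp_all add: Y_def V_def W_def)
  have "Y ^ 7 * (Y * W) = Y ^ 7 * V" using YV YW by (simp add: power_Suc2[symmetric] mult.assoc[symmetric])
  then have YWV: "Y * W = V"
    using YV by (metis mult_cancel_left mult_zero_left zero_neq_one)
  have "((F * Y ^ 2) ^ 7 - ((f * Y) ^ 7 - 7 * (f * Y) ^ 6 * b)) * (V * V) \<in> J (2 * r)"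
    using 3 by (intro J_mult_right J_mult_left) (simp_all add: V_def binomial_fps_J)
  also have "((F * Y ^ 2) ^ 7 - ((f * Y) ^ 7 - 7 * (f * Y) ^ 6 * b)) * (V * V)
      = F ^ 7 * (Y ^ 7 * V) ^ 2 - f ^ 7 * V * (Y ^ 7 * V)
        + 7 * f ^ 6 * b * (Y ^ 6 * (Y * W) * V)"
    unfolding YWV by (simp add: algebra_simps power2_eq_square flip: power_add power_mult)
  also have "Y ^ 6 * (Y * W) * V = W * (Y ^ 7 * V)"
    by (simp add: algebra_simps flip: power_Suc)
  also have "F ^ 7 * (Y ^ 7 * V) ^ 2 - f ^ 7 * V * (Y ^ 7 * V) + 7 * f ^ 6 * b * (W * (Y ^ 7 * V))
      = F ^ 7 - f ^ 7 * V + 7 * f ^ 6 * b * W"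
    unfolding YV by simp
  also have "7 * f ^ 6 * b * W = fps_const (7 * of_nat q) * (f ^ 6 * g * (fps_X ^ q * W))"
    by (simp add: b_def algebra_simps fps_numeral_fps_const)
  finally show ?thesis
    by (simp only: F_def f_def g_def V_def W_def diff_diff_eq2 add_diff_eq diff_add_eq)
qed

text \<open>
  The binomial coefficient \<open>(M + 6 - t) choose 6\<close> counts the seven-tuples of quotients with sum
  \<open>M - t\<close>. The first-order term carries \<open>(M + 6 - t) choose 7\<close>, which by symmetry is
  \<open>(M - t) / 7\<close> times that number: the sum of one quotient over all these tuples.
\<close>
lemma harmonic_sum_expansion:
  fixes r M :: nat
  defines "q \<equiv> p ^ r"
  assumes r: "r > 0"
  shows "multiple_harmonic_sum 7 p (M * q)
      - ((\<Sum>t = 1..6. fps_nth (layer_fps q 1 ^ 7) (t * q) * of_nat ((M + 6 - t) choose 6))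
        - 7 * of_nat q * (\<Sum>t = 1..6. fps_nth (layer_fps q 1 ^ 6 * layer_fps q 2) (t * q)
            * of_nat ((M + 6 - t) choose 7))) \<in> I (2 * r)"
proof -
  have q0: "q > 0" using p_pos by (simp add: q_def)
  have f: "fps_nth (layer_fps q e) i = 0" if "i > q - 1" for i e
    using that by (auto simp: layer_fps_def)
  have f0: "fps_nth (layer_fps q e) 0 = 0" for e
    by (auto simp: layer_fps_def)
  have f6: "fps_nth (layer_fps q 1 ^ 6) i = 0" if "i > 6 * (q - 1)" for i
    using f that by (rule fps_power_nth_eq_0_degree)
  have big: "6 * (q - 1) + (q - 1) < t * q" if "t > 6" for t
  proof -
    have "6 * (q - 1) + (q - 1) < 7 * q" using q0 by simp
    also have "\<dots> \<le> t * q" using that by (intro mult_right_mono) auto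
    finally show ?thesis .
  qed
  have u1: "fps_nth (layer_fps q 1 ^ 7) (t * q) = 0" if "t = 0 \<or> t > 6" for t
    using that
  proof
    assume "t > 6"
    then show ?thesis
      using big[of t] f by (intro fps_power_nth_eq_0_degree[of "q - 1"]) auto
  qed (simp add: fps_power_zeroth f0)
  have u2: "fps_nth (layer_fps q 1 ^ 6 * layer_fps q 2) (t * q) = 0" if "t = 0 \<or> t > 6" for t
    using that
  proof
    assume "t > 6"
    then show ?thesis
      using big[of t] f6 f by (intro fps_mult_nth_eq_0_degree[of "6 * (q - 1)" _ "q - 1"]) auto
  qed (simp add: f0)
  have V: "fps_nth (layer_fps q 1 ^ 7 * binomial_fps q 6) (M * q) =
      (\<Sum>t = 1..6. fps_nth (layer_fps q 1 ^ 7) (t * q) * of_nat ((M + 6 - t) choose 6))"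
    by (rule nth_mult_supported_on_multiples) (use q0 u1 in \<open>auto simp: binomial_fps_def\<close>)
  have W: "fps_nth (layer_fps q 1 ^ 6 * layer_fps q 2 * (fps_X ^ q * binomial_fps q 7)) (M * q) =
      (\<Sum>t = 1..6. fps_nth (layer_fps q 1 ^ 6 * layer_fps q 2) (t * q) * of_nat ((M + 6 - t) choose 7))"
  proof (rule nth_mult_supported_on_multiples)
    show "fps_nth (fps_X ^ q * binomial_fps q 7) (a * q) = of_nat ((a + 6) choose 7)" for a
      using fps_shifted_binomial_fps_nth[OF q0, of 6 a] by simp
    show "fps_nth (fps_X ^ q * binomial_fps q 7) n = 0" if "\<not> q dvd n" for n
      using that by (auto simp: fps_X_power_mult_nth binomial_fps_def dvd_minus_self)
  qed (use q0 u2 in auto)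
  show ?thesis
    using J_nth[OF harmonic_seventh_power[OF _ r, of q], of "M * q"] V W
    by (simp add: q_def multiple_harmonic_sum_eq_nth)
qed

end

section \<open>Lifting from q to pq\<close>

text \<open>
  The coefficients of the polynomial \<open>(1 - y)\<^sup>7 \<Sum> (a M + b M\<^sup>3 + c M\<^sup>5) y\<^sup>M\<close>, found from the Eulerian
  polynomials in \<open>\<Sum> M y\<^sup>M = y / (1 - y)\<^sup>2\<close>, \<open>\<Sum> M\<^sup>3 y\<^sup>M = y (1 + 4 y + y\<^sup>2) / (1 - y)\<^sup>4\<close> and
  \<open>\<Sum> M\<^sup>5 y\<^sup>M = y (1 + 26 y + 66 y\<^sup>2 + 26 y\<^sup>3 + y\<^sup>4) / (1 - y)\<^sup>6\<close>. They are the layers that produce the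
  polynomial \<open>a M + b M\<^sup>3 + c M\<^sup>5\<close>.
\<close>
fun eulerian_weight :: "rat \<Rightarrow> rat \<Rightarrow> rat \<Rightarrow> nat \<Rightarrow> rat" where
  "eulerian_weight a b c t =
    (if t = 1 then a + b + c else if t = 2 then - 5 * a + b + 25 * c
     else if t = 3 then 10 * a - 8 * b + 40 * c else if t = 4 then - 10 * a + 8 * b - 40 * c
     else if t = 5 then 5 * a - b - 25 * c else - a - b - c)"

lemma sum_1_6: "(\<Sum>t = 1..6. f t) = f 1 + f 2 + f 3 + f 4 + f 5 + f (6 :: nat)"
  for f :: "nat \<Rightarrow> 'a :: comm_monoid_add"
proof -
  have "{1..6} = {1, 2, 3, 4, 5, 6 :: nat}" by auto
  then show ?thesis by (simp add: add.assoc)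
qed

text \<open>
  Also valid for \<open>M < t\<close>, where one of the six factors of the product is zero.
\<close>
lemma of_nat_choose_6:
  assumes "t \<le> 6"
  shows "(of_nat ((M + 6 - t) choose 6) :: rat)
    = (\<Prod>i = 0..<6. of_nat M + 6 - of_nat t - of_nat i) / 720"
proof -
  have "of_nat (M + 6 - t) = (of_nat M + 6 - of_nat t :: rat)"
    using assms by (simp add: of_nat_diff)
  then show ?thesis
    using gbinomial_mult_fact[of 6 "of_nat (M + 6 - t) :: rat"]
    by (simp add: binomial_gbinomial fact_numeral)
qed

text \<open>
  A form of Worpitzky's identity, with the three powers written in binomial coefficients of degree six.
\<close>
lemma worpitzky:
  "(\<Sum>t = 1..6. eulerian_weight a b c t * of_nat ((M + 6 - t) choose 6))
    = a * of_nat M + b * of_nat M ^ 3 + c * of_nat M ^ 5"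
proof -
  define x where "x = (of_nat M :: rat)"
  have prod6: "(\<Prod>i = 0..<6. y - of_nat i) = y * (y - 1) * (y - 2) * (y - 3) * (y - 4) * (y - 5)"
    for y :: rat
    by (simp add: eval_nat_numeral)
  have choose: "of_nat ((M + 6 - t) choose 6) = (let y = x + 6 - of_nat t in
      y * (y - 1) * (y - 2) * (y - 3) * (y - 4) * (y - 5)) / 720" if "t \<le> 6" for t
    using of_nat_choose_6[OF that, of M] by (simp only: prod6 x_def Let_def)
  have "(\<Sum>t = 1..6. eulerian_weight a b c t * of_nat ((M + 6 - t) choose 6))
      = (\<Sum>t = 1..6. eulerian_weight a b c t * ((let y = x + 6 - of_nat t in
          y * (y - 1) * (y - 2) * (y - 3) * (y - 4) * (y - 5)) / 720))"
    by (intro sum.cong refl) (simp only: choose atLeastAtMost_iff)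
  also have "\<dots> = a * x + b * x ^ 3 + c * x ^ 5"
    unfolding sum_1_6 Let_def by (simp add: field_simps) (simp add: eval_nat_numeral)
  finally show ?thesis by (simp only: x_def)
qed

context prime_local
begin

lemma choose_in_I:
  assumes "k < p" "k > 5" "t \<in> {1..6}" "p dvd M"
  shows "of_nat ((M + 6 - t) choose k) \<in> I 1"
proof -
  have "p dvd (M + 6 - t) choose k"
    using assms by (intro prime_dvd_choose_if_dvd_factor[OF prime_p, of k "6 - t"]) auto
  then show ?thesis using I_of_nat_dvd[of 1] by simp
qed

text \<open>
  If \<open>p\<close> divides \<open>M\<close>, all the binomial coefficients in \<open>harmonic_sum_expansion\<close> are divisible by \<open>p\<close>: six
  or seven factors of the numerator, counted down from \<open>M + 6 - t\<close>, include \<open>M\<close>. This gains one power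
  of \<open>p\<close>, both for the error in the layers and for the term of first order in \<open>q\<close>.
\<close>
lemma harmonic_sum_from_layers:
  fixes r :: nat
  defines "q \<equiv> p ^ r"
  assumes r: "r > 0" and p7: "p > 7"
    and layers: "\<And>t. t \<in> {1..6} \<Longrightarrow>
      fps_nth (layer_fps q 1 ^ 7) (t * q) - eulerian_weight a b c t \<in> I r"
  shows "multiple_harmonic_sum 7 p (M * q)
        - (a * of_nat M + b * of_nat M ^ 3 + c * of_nat M ^ 5) \<in> I r" (is ?thesis1)
    and "p dvd M \<Longrightarrow> multiple_harmonic_sum 7 p (M * q)
        - (a * of_nat M + b * of_nat M ^ 3 + c * of_nat M ^ 5) \<in> I (Suc r)"
proof -
  \<comment> \<open>Both cases are one statement modulo \<open>p\<^sup>s\<close>.\<close>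
  define s where "s = (if p dvd M then Suc r else r)"
  have s: "s \<le> 2 * r" using r by (simp add: s_def)
  let ?T = "\<lambda>t. fps_nth (layer_fps q 1 ^ 7) (t * q)"
  let ?U = "\<lambda>t. fps_nth (layer_fps q 1 ^ 6 * layer_fps q 2) (t * q)"
  let ?c = "\<lambda>k t. of_nat ((M + 6 - t) choose k) :: rat"
  have ck: "?c k t \<in> I (s - r)" if "t \<in> {1..6}" "k = 6 \<or> k = 7" for k t
    using choose_in_I[of k t M] that p7 by (cases "p dvd M") (auto simp: s_def)
  have rs: "r + (s - r) = s" by (simp add: s_def)
  have qI: "of_nat q \<in> I r" using I_p_power[of r] by (simp add: q_def)
  have UI: "layer_fps q 1 ^ 6 * layer_fps q 2 \<in> J 0"
    by (intro J_mult_left J_power layer_fps_J)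
  have 1: "multiple_harmonic_sum 7 p (M * q)
      - ((\<Sum>t = 1..6. ?T t * ?c 6 t) - 7 * of_nat q * (\<Sum>t = 1..6. ?U t * ?c 7 t)) \<in> I s"
    using harmonic_sum_expansion[OF r, of M] s unfolding q_def by (rule I_mono)
  have "7 * of_nat q \<in> I r" using qI by (rule I_mult_left[OF I_numeral])
  moreover have "(\<Sum>t = 1..6. ?U t * ?c 7 t) \<in> I (s - r)"
    using ck by (intro I_sum I_mult_left J_nth[OF UI]) auto
  ultimately have 2: "7 * of_nat q * (\<Sum>t = 1..6. ?U t * ?c 7 t) \<in> I s"
    using I_mult rs by metis
  have "(\<Sum>t = 1..6. (?T t - eulerian_weight a b c t) * ?c 6 t) \<in> I (r + (s - r))"
    using ck layers by (intro I_sum I_mult) auto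
  then have 3: "(\<Sum>t = 1..6. ?T t * ?c 6 t) - (a * of_nat M + b * of_nat M ^ 3 + c * of_nat M ^ 5) \<in> I s"
    unfolding rs worpitzky[of a b c M, symmetric] sum_subtractf[symmetric] left_diff_distrib .
  have 4: "multiple_harmonic_sum 7 p (M * q)
        - (a * of_nat M + b * of_nat M ^ 3 + c * of_nat M ^ 5) \<in> I s"
    using I_diff[OF I_add[OF 1 3] 2] by (simp add: algebra_simps)
  show ?thesis1
    using 4 by (rule I_mono) (simp add: s_def)
  show "multiple_harmonic_sum 7 p (M * q)
        - (a * of_nat M + b * of_nat M ^ 3 + c * of_nat M ^ 5) \<in> I (Suc r)" if "p dvd M"
    using 4 that by (simp add: s_def)
qed

text \<open>
  For \<open>M = 1, \<dots>, 6\<close> the matrix of the \<open>(M + 6 - t) choose 6\<close> is triangular with ones on the diagonal.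
\<close>
lemma layers_from_harmonic_sum:
  fixes r :: nat
  defines "q \<equiv> p ^ r"
  assumes r: "r > 0"
    and sums: "\<And>M. multiple_harmonic_sum 7 p (M * q)
        - (a * of_nat M + b * of_nat M ^ 3 + c * of_nat M ^ 5) \<in> I r"
    and t: "t \<in> {1..6}"
  shows "fps_nth (layer_fps q 1 ^ 7) (t * q) - eulerian_weight a b c t \<in> I r"
proof -
  let ?T = "\<lambda>t. fps_nth (layer_fps q 1 ^ 7) (t * q)"
  let ?U = "\<lambda>t. fps_nth (layer_fps q 1 ^ 6 * layer_fps q 2) (t * q)"
  define d where "d t = ?T t - eulerian_weight a b c t" for t
  have qI: "of_nat q \<in> I r" using I_p_power[of r] by (simp add: q_def)
  have UI: "layer_fps q 1 ^ 6 * layer_fps q 2 \<in> J 0"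
    by (intro J_mult_left J_power layer_fps_J)
  have main: "(\<Sum>t = 1..6. d t * of_nat ((M + 6 - t) choose 6)) \<in> I r" for M
  proof -
    let ?c = "\<lambda>k t. of_nat ((M + 6 - t) choose k) :: rat"
    have 1: "multiple_harmonic_sum 7 p (M * q)
        - ((\<Sum>t = 1..6. ?T t * ?c 6 t) - 7 * of_nat q * (\<Sum>t = 1..6. ?U t * ?c 7 t)) \<in> I r"
      using harmonic_sum_expansion[OF r, of M] unfolding q_def by (rule I_mono) simp
    have 2: "7 * of_nat q * (\<Sum>t = 1..6. ?U t * ?c 7 t) \<in> I r"
      by (intro I_mult_right[of _ r] I_mult_left[OF I_numeral] qI I_sum)
        (intro I_mult_left[of _ _ 0] J_nth[OF UI] I_of_nat)
    have "(\<Sum>t = 1..6. ?T t * ?c 6 t) - (a * of_nat M + b * of_nat M ^ 3 + c * of_nat M ^ 5) \<in> I r"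
      using I_diff[OF I_add[OF I_uminus[OF 1] sums[of M]] I_uminus[OF 2]] by (simp add: algebra_simps)
    then show ?thesis
      unfolding worpitzky[of a b c M, symmetric] sum_subtractf[symmetric] left_diff_distrib[symmetric] d_def .
  qed
  have "d t \<in> I r"
    using t
  proof (induction t rule: less_induct)
    case (less t)
    have eq: "(\<Sum>s = 1..6. d s * of_nat ((t + 6 - s) choose 6))
        = d t * of_nat ((t + 6 - t) choose 6) + (\<Sum>s \<in> {1..6} - {t}. d s * of_nat ((t + 6 - s) choose 6))"
      using less.prems by (intro sum.remove) auto
    have rest: "(\<Sum>s \<in> {1..6} - {t}. d s * of_nat ((t + 6 - s) choose 6)) \<in> I r"
    proof (rule I_sum)
      fix s assume s: "s \<in> {1..6} - {t}"
      show "d s * of_nat ((t + 6 - s) choose 6) \<in> I r"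
      proof (cases "s < t")
        case True
        then show ?thesis using less.IH[of s] s by (intro I_mult_right) auto
      next
        case False
        then have "(t + 6 - s) choose 6 = 0" using s by (intro binomial_eq_0) auto
        then show ?thesis by (simp only: of_nat_0 mult_zero_right I_zero)
      qed
    qed
    have "d t * of_nat ((t + 6 - t) choose 6) \<in> I r"
      using I_diff[OF main[of t] rest] unfolding eq by (simp only: add_diff_cancel_right')
    then show ?case by simp
  qed
  then show ?thesis by (simp only: d_def)
qed

text \<open>
  Every layer congruence modulo \<open>q\<close> yields the polynomial for \<open>p q\<close> by substituting \<open>p M\<close> for \<open>M\<close>, so
  one polynomial serves all exponents.
\<close>
lemma harmonic_sum_induction:
  assumes p7: "p > 7"
    and base: "\<And>t. t \<in> {1..6} \<Longrightarrow>
      fps_nth (layer_fps p 1 ^ 7) (t * p) - eulerian_weight a b c t \<in> I 1"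
  shows "multiple_harmonic_sum 7 p (M * p ^ Suc n)
    - (a * of_nat (p ^ n * M) + b * of_nat (p ^ n * M) ^ 3 + c * of_nat (p ^ n * M) ^ 5) \<in> I (Suc n)"
proof (induction n arbitrary: M)
  case 0
  show ?case
    using harmonic_sum_from_layers(1)[of 1 a b c M] base p7 by simp
next
  case (Suc n)
  let ?a = "a * of_nat (p ^ n)" and ?b = "b * of_nat (p ^ n) ^ 3" and ?c = "c * of_nat (p ^ n) ^ 5"
  have "multiple_harmonic_sum 7 p (M * p ^ Suc n)
      - (?a * of_nat M + ?b * of_nat M ^ 3 + ?c * of_nat M ^ 5) \<in> I (Suc n)" for M
    using Suc[of M] by (simp only: of_nat_mult power_mult_distrib mult.assoc)
  then have "fps_nth (layer_fps (p ^ Suc n) 1 ^ 7) (t * p ^ Suc n) - eulerian_weight ?a ?b ?c t \<in> I (Suc n)"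
    if "t \<in> {1..6}" for t
    using that by (intro layers_from_harmonic_sum) auto
  then have "multiple_harmonic_sum 7 p ((p * M) * p ^ Suc n)
      - (?a * of_nat (p * M) + ?b * of_nat (p * M) ^ 3 + ?c * of_nat (p * M) ^ 5) \<in> I (Suc (Suc n))"
    using p7 by (intro harmonic_sum_from_layers(2)) auto
  moreover have "(p * M) * p ^ Suc n = M * p ^ Suc (Suc n)" by simp
  moreover have "?a * of_nat (p * M) + ?b * of_nat (p * M) ^ 3 + ?c * of_nat (p * M) ^ 5
      = a * of_nat (p ^ Suc n * M) + b * of_nat (p ^ Suc n * M) ^ 3 + c * of_nat (p ^ Suc n * M) ^ 5"
    by (simp add: power_mult_distrib algebra_simps)
  ultimately show ?case by (simp only:)
qed

end

section \<open>Bernoulli numbers and power sums\<close>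

lemma bernoulli_fps_nth_rec:
  "fps_nth bernoulli_fps k =
    (if k = 0 then 1 else 0) - (\<Sum>i<k. fps_nth bernoulli_fps i / fact (Suc k - i))"
proof -
  have "fps_nth fps_X (Suc k) = (\<Sum>i = 0..Suc k. fps_nth bernoulli_fps i * fps_nth (fps_exp 1 - 1) (Suc k - i))"
    by (simp only: fps_mult_nth flip: bernoulli_fps_mult)
  also have "\<dots> = (\<Sum>i = 0..k. fps_nth bernoulli_fps i * fps_nth (fps_exp 1 - 1) (Suc k - i))"
    by simp
  also have "\<dots> = (\<Sum>i = 0..k. fps_nth bernoulli_fps i / fact (Suc k - i))"
    by (intro sum.cong) auto
  also have "\<dots> = fps_nth bernoulli_fps k + (\<Sum>i<k. fps_nth bernoulli_fps i / fact (Suc k - i))"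
    by (simp add: atLeast0AtMost lessThan_Suc_atMost[symmetric])
  finally show ?thesis by (simp add: fps_X_def split: if_splits)
qed

text \<open>
  With \<open>b(x) = x / (e\<^sup>x - 1)\<close> one has \<open>b(-x) = b(x) + x\<close>, so \<open>b(x) + x/2\<close> is even.
\<close>
lemma bernoulli_odd_eq_0:
  assumes "odd k" "k > 1"
  shows "bernoulli k = 0"
proof -
  define b where "b = (bernoulli_fps :: rat fps)"
  define e where "e = (fps_exp 1 :: rat fps)"
  define b' where "b' = b oo - fps_X"
  have be: "b * (e - 1) = fps_X"
    unfolding b_def e_def by (rule bernoulli_fps_mult)
  have "b' * ((e - 1) oo - fps_X) = (b * (e - 1)) oo - fps_X"
    unfolding b'_def by (simp add: fps_compose_mult_distrib)
  then have "b' * ((e - 1) oo - fps_X) = fps_X oo - fps_X"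
    by (simp only: be)
  moreover have "(e - 1) oo - fps_X = fps_exp (- 1) - 1"
    by (simp add: e_def fps_compose_sub_distrib)
  ultimately have 1: "b' * (fps_exp (- 1) - 1) = - fps_X" by (simp del: fps_X_fps_compose)
  have ee: "fps_exp (- 1) * e = 1"
    unfolding e_def using fps_exp_add_mult[of "- 1" "1 :: rat"] by simp
  have "b' * (e - 1) = - (b' * (fps_exp (- 1) - 1)) * e"
    using ee by (simp add: algebra_simps mult.assoc)
  also have "\<dots> = fps_X * e" unfolding 1 by simp
  also have "\<dots> = (b + fps_X) * (e - 1)"
    using be by (simp add: algebra_simps)
  finally have "(b' - (b + fps_X)) * (e - 1) = 0" by (simp add: algebra_simps)
  moreover have "e - 1 \<noteq> 0"
  proof
    assume "e - 1 = 0"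
    then have "fps_nth (e - 1) 1 = 0" by simp
    then show False by (simp add: e_def)
  qed
  ultimately have "b' = b + fps_X" by auto
  then have "fps_nth b' k = fps_nth (b + fps_X) k" by simp
  then have "(-1) ^ k * fps_nth b k = fps_nth b k"
    using assms by (simp add: b'_def fps_compose_uminus')
  then show ?thesis
    using assms by (simp add: bernoulli_def b_def)
qed

text \<open>
  Bernoulli's formula, read off from \<open>\<Sum> e\<^bsup>lx\<^esup> = (e\<^bsup>Nx\<^esup> - 1) / (e\<^sup>x - 1)\<close>.
\<close>
lemma power_sum_bernoulli:
  "(\<Sum>l<N. of_nat l ^ n) = fact n * (\<Sum>i\<le>n. fps_nth bernoulli_fps i * of_nat N ^ (Suc n - i) / fact (Suc n - i))"
proof -
  have geo: "(fps_exp 1 - 1) * (\<Sum>l<N. fps_exp (of_nat l)) = fps_exp (of_nat N) - (1 :: rat fps)"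
  proof (induction N)
    case (Suc N)
    then show ?case
      by (simp add: distrib_left) (simp add: algebra_simps fps_exp_add_mult)
  qed simp
  have "bernoulli_fps * (fps_exp (of_nat N) - 1) = fps_X * (\<Sum>l<N. fps_exp (of_nat l))"
    unfolding geo[symmetric] bernoulli_fps_mult[symmetric] by (simp add: mult.assoc)
  then have "fps_nth (fps_X * (\<Sum>l<N. fps_exp (of_nat l))) (Suc n)
      = fps_nth (bernoulli_fps * (fps_exp (of_nat N) - 1)) (Suc n)" by simp
  then have "(\<Sum>l<N. of_nat l ^ n) / fact n
      = (\<Sum>i = 0..Suc n. fps_nth bernoulli_fps i * fps_nth (fps_exp (of_nat N) - 1) (Suc n - i))"
    by (simp add: fps_sum_nth sum_divide_distrib fps_mult_nth[of bernoulli_fps] del: sum.atLeast0_atMost_Suc)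
  also have "\<dots> = (\<Sum>i = 0..n. fps_nth bernoulli_fps i * fps_nth (fps_exp (of_nat N) - 1) (Suc n - i))"
    by simp
  also have "\<dots> = (\<Sum>i\<le>n. fps_nth bernoulli_fps i * of_nat N ^ (Suc n - i) / fact (Suc n - i))"
    by (intro sum.cong) auto
  finally show ?thesis by (simp add: field_simps)
qed

section \<open>Newton identities and the products of 1 + pa/l\<close>

text \<open>
  Compare coefficients in the logarithmic derivative \<open>E' = E \<Sum> c\<^sub>l / (1 + c\<^sub>l x)\<close>.
\<close>
lemma newton_identity:
  fixes c :: "'a \<Rightarrow> rat"
  assumes "finite A"
  defines "E \<equiv> (\<Prod>l\<in>A. 1 + fps_const (c l) * fps_X)"
  shows "of_nat (Suc n) * fps_nth E (Suc n) =
    (\<Sum>i = 0..n. fps_nth E i * ((-1) ^ (n - i) * (\<Sum>l\<in>A. c l ^ Suc (n - i))))"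
proof -
  have "fps_deriv E = E * Abs_fps (\<lambda>n. (-1) ^ n * (\<Sum>l\<in>A. c l ^ Suc n))"
    unfolding E_def using assms(1)
  proof (induction A)
    case empty
    show ?case by (simp add: fps_eq_iff fps_mult_nth)
  next
    case (insert a A)
    let ?P = "\<lambda>A. Abs_fps (\<lambda>n. (-1) ^ n * (\<Sum>l\<in>A. c l ^ Suc n))"
    let ?E = "\<Prod>l\<in>A. 1 + fps_const (c l) * fps_X"
    have P: "?P (insert a A) = Abs_fps (\<lambda>n. (-1) ^ n * c a ^ Suc n) + ?P A"
      using insert by (simp add: fps_eq_iff algebra_simps)
    have lin: "(1 + fps_const (c a) * fps_X) * Abs_fps (\<lambda>n. (-1) ^ n * c a ^ Suc n) = fps_const (c a)"
    proof (rule fps_ext)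
      fix n show "fps_nth ((1 + fps_const (c a) * fps_X) * Abs_fps (\<lambda>n. (-1) ^ n * c a ^ Suc n)) n
        = fps_nth (fps_const (c a)) n"
        by (cases n) (simp_all add: distrib_right mult.assoc)
    qed
    have "fps_deriv (\<Prod>l\<in>insert a A. 1 + fps_const (c l) * fps_X)
        = fps_const (c a) * ?E + (1 + fps_const (c a) * fps_X) * (?E * ?P A)"
      using insert by simp
    also have "\<dots> = (1 + fps_const (c a) * fps_X) * Abs_fps (\<lambda>n. (-1) ^ n * c a ^ Suc n) * ?E
        + (1 + fps_const (c a) * fps_X) * (?E * ?P A)"
      by (simp only: lin)
    also have "\<dots> = (1 + fps_const (c a) * fps_X) * ?E * ?P (insert a A)"
      unfolding P distrib_left by (simp only: ac_simps)
    finally show ?case using insert by simp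
  qed
  then have "fps_nth (fps_deriv E) n = fps_nth (E * Abs_fps (\<lambda>n. (-1) ^ n * (\<Sum>l\<in>A. c l ^ Suc n))) n"
    by simp
  then show ?thesis by (simp add: fps_mult_nth)
qed

context prime_local
begin

lemma not_dvd_fact: "n < p \<Longrightarrow> \<not> p dvd fact n"
  using prime_p by (simp add: prime_dvd_fact_iff)

lemma I_divide_fact: "n < p \<Longrightarrow> x \<in> I k \<Longrightarrow> x / fact n \<in> I k"
  using I_mult_right[OF _ I_inverse_of_nat[OF not_dvd_fact], of x k n] by simp

text \<open>
  By the recurrence, whose denominators are factorials of numbers below \<open>p\<close>.
\<close>
lemma bernoulli_fps_I: "k + 1 < p \<Longrightarrow> fps_nth bernoulli_fps k \<in> I 0"
proof (induction k rule: less_induct)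
  case (less k)
  have "fps_nth bernoulli_fps i / fact (Suc k - i) \<in> I 0" if "i < k" for i
    using less that by (intro I_divide_fact) auto
  then show ?case
    by (subst bernoulli_fps_nth_rec) (auto intro!: I_diff I_sum)
qed

lemma bernoulli_I: "k + 1 < p \<Longrightarrow> bernoulli k \<in> I 0"
  using I_mult_left[OF I_of_nat bernoulli_fps_I, of k "fact k"] by (simp add: bernoulli_def)

text \<open>
  In Bernoulli's formula for \<open>N = p\<close> all other terms contain at least \<open>p\<^sup>2\<close>.
\<close>
lemma power_sum_cong:
  assumes "n + 1 < p"
  shows "(\<Sum>l<p. of_nat l ^ n) - of_nat p * bernoulli n \<in> I 2"
proof -
  let ?g = "\<lambda>i. fps_nth bernoulli_fps i * of_nat p ^ (Suc n - i) / fact (Suc n - i)"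
  have "(\<Sum>l<p. of_nat l ^ n) = fact n * (?g n + (\<Sum>i<n. ?g i))"
    by (simp only: power_sum_bernoulli lessThan_Suc_atMost[symmetric] sum.lessThan_Suc add.commute)
  also have "\<dots> = of_nat p * bernoulli n + fact n * (\<Sum>i<n. ?g i)"
    by (simp add: bernoulli_def algebra_simps)
  finally have "(\<Sum>l<p. of_nat l ^ n) - of_nat p * bernoulli n = of_nat (fact n) * (\<Sum>i<n. ?g i)"
    by simp
  moreover have "?g i \<in> I 2" if "i < n" for i
    using assms that
    by (intro I_divide_fact I_mult_left bernoulli_fps_I I_mono[OF I_p_power[of "Suc n - i"]]) auto
  ultimately show ?thesis
    by (metis (no_types, lifting) I_mult_left I_of_nat I_sum lessThan_iff)
qed

text \<open>
  The coefficient at \<open>k\<close> is the elementary symmetric function \<open>e\<^sub>k(1, \<dots>, p - 1)\<close>.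
\<close>
definition elem_sym_fps :: "rat fps" where
  "elem_sym_fps = (\<Prod>l\<in>{1..<p}. 1 + fps_const (of_nat l) * fps_X)"

lemma J_prod: "(\<And>i. i \<in> A \<Longrightarrow> f i \<in> J 0) \<Longrightarrow> prod f A \<in> J 0"
  by (induction A rule: infinite_finite_induct) (auto intro: J_one J_mult_left)

lemma elem_sym_fps_J: "elem_sym_fps \<in> J 0"
  unfolding elem_sym_fps_def by (intro J_prod) (auto simp: J_def fps_X_def)

lemma power_sum_I:
  assumes "0 < n" "n + 1 < p"
  shows "(\<Sum>l\<in>{1..<p}. of_nat l ^ n) - of_nat p * bernoulli n \<in> I 2"
    and "(\<Sum>l\<in>{1..<p}. of_nat l ^ n) \<in> I 1"
proof -
  have "{..<p} = insert 0 {1..<p}" using p_pos by auto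
  then have "(\<Sum>l<p. of_nat l ^ n) = (\<Sum>l\<in>{1..<p}. of_nat l ^ n :: rat)"
    using assms by simp
  then show 1: "(\<Sum>l\<in>{1..<p}. of_nat l ^ n) - of_nat p * bernoulli n \<in> I 2"
    using power_sum_cong[OF assms(2)] by simp
  have "of_nat p * bernoulli n \<in> I 1"
    using I_mult[OF I_p_power[of 1] bernoulli_I[OF assms(2)]] by simp
  then show "(\<Sum>l\<in>{1..<p}. of_nat l ^ n) \<in> I 1"
    using I_cong[OF I_mono[OF 1]] by simp
qed

text \<open>
  In Newton's identity every summand contains a power sum, which is divisible by \<open>p\<close>; this gives the
  first claim. Consequently all summands but the one with \<open>e\<^sub>0 = 1\<close> are divisible by \<open>p\<^sup>2\<close>, and the power
  sum that is left is congruent to \<open>p\<close> times a Bernoulli number.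
\<close>
lemma elem_sym_fps_cong:
  assumes n: "Suc n + 1 < p"
  shows "fps_nth elem_sym_fps (Suc n) \<in> I 1"
    and "of_nat (Suc n) * fps_nth elem_sym_fps (Suc n) - (-1) ^ n * (of_nat p * bernoulli (Suc n)) \<in> I 2"
proof -
  define P where "P n = (\<Sum>l\<in>{1..<p}. of_nat l ^ n :: rat)" for n
  have newton: "of_nat (Suc n) * fps_nth elem_sym_fps (Suc n)
      = (\<Sum>i = 0..n. fps_nth elem_sym_fps i * ((-1) ^ (n - i) * P (Suc (n - i))))" for n
    unfolding elem_sym_fps_def P_def by (rule newton_identity) simp
  have sgn: "(-1) ^ k \<in> I 0" for k
    by (intro I_power I_uminus I_one)
  have PI: "(-1) ^ (n - i) * P (Suc (n - i)) \<in> I 1" if "Suc n + 1 < p" for n i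
    using that unfolding P_def by (intro I_mult_left[OF sgn] power_sum_I) auto
  have EI: "fps_nth elem_sym_fps (Suc n) \<in> I 1" if "Suc n + 1 < p" for n
  proof (rule I_cancel)
    show "of_nat (Suc n) * fps_nth elem_sym_fps (Suc n) \<in> I 1"
      unfolding newton using that by (intro I_sum I_mult_left[OF J_nth[OF elem_sym_fps_J]] PI)
    show "\<not> p dvd Suc n" using that by (auto dest: dvd_imp_le)
  qed
  show "fps_nth elem_sym_fps (Suc n) \<in> I 1" using n by (rule EI)
  have E0: "fps_nth elem_sym_fps 0 = 1"
  proof -
    have "fps_nth (prod f A) 0 = (\<Prod>l\<in>A. fps_nth (f l) 0)" for f :: "nat \<Rightarrow> rat fps" and A
      by (induction A rule: infinite_finite_induct) auto
    then show ?thesis by (simp add: elem_sym_fps_def)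
  qed
  have "of_nat (Suc n) * fps_nth elem_sym_fps (Suc n)
      = (-1) ^ n * P (Suc n) + (\<Sum>i = Suc 0..n. fps_nth elem_sym_fps i * ((-1) ^ (n - i) * P (Suc (n - i))))"
    unfolding newton by (subst sum.atLeast_Suc_atMost) (simp_all add: E0)
  moreover have "(\<Sum>i = Suc 0..n. fps_nth elem_sym_fps i * ((-1) ^ (n - i) * P (Suc (n - i)))) \<in> I 2"
  proof (rule I_sum)
    fix i assume i: "i \<in> {Suc 0..n}"
    then have "fps_nth elem_sym_fps i \<in> I 1" using EI[of "i - 1"] n by simp
    then show "fps_nth elem_sym_fps i * ((-1) ^ (n - i) * P (Suc (n - i))) \<in> I 2"
      using I_mult[OF _ PI[OF n]] by (metis one_add_one)
  qed
  moreover have "(-1) ^ n * (P (Suc n) - of_nat p * bernoulli (Suc n)) \<in> I 2"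
    using n unfolding P_def by (intro I_mult_left[OF sgn] power_sum_I) auto
  moreover have "(y - z) + x \<in> I 2 \<Longrightarrow> y + x - z \<in> I 2" for x y z :: rat
    by (simp add: algebra_simps)
  ultimately show "of_nat (Suc n) * fps_nth elem_sym_fps (Suc n)
      - (-1) ^ n * (of_nat p * bernoulli (Suc n)) \<in> I 2"
    using I_add unfolding right_diff_distrib by (simp only:)
qed

lemma prod_shift_expansion:
  "(\<Prod>l\<in>{1..<p}. of_nat l + x) = (\<Sum>k\<le>p - 1. fps_nth elem_sym_fps (p - 1 - k) * x ^ k)"
proof -
  define Q :: "rat poly" where "Q = (\<Prod>l\<in>{1..<p}. [:of_nat l, 1:])"
  have deg: "degree Q = p - 1"
    unfolding Q_def by (subst degree_prod_sum_eq) auto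
  have "elem_sym_fps = fps_of_poly (reflect_poly Q)"
    unfolding elem_sym_fps_def Q_def reflect_poly_prod fps_of_poly_prod
  proof (rule prod.cong)
    fix l assume "l \<in> {1..<p}"
    then show "1 + fps_const (of_nat l) * fps_X = fps_of_poly (reflect_poly [:of_nat l :: rat, 1:])"
      by (auto simp: reflect_poly_def fps_of_poly_pCons)
  qed simp
  then have coeff: "fps_nth elem_sym_fps (p - 1 - k) = Polynomial.coeff Q k" if "k \<le> p - 1" for k
    using that p_pos
    by (auto simp: coeff_reflect_poly deg intro!: arg_cong[of _ _ "Polynomial.coeff Q"])
  have "(\<Prod>l\<in>{1..<p}. of_nat l + x) = poly Q x"
    by (simp add: Q_def poly_prod)
  also have "\<dots> = (\<Sum>k\<le>p - 1. fps_nth elem_sym_fps (p - 1 - k) * x ^ k)"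
    unfolding poly_altdef deg by (intro sum.cong refl) (simp only: coeff atMost_iff)
  finally show ?thesis .
qed

text \<open>
  The number \<open>\<Prod>(1 + p a / l)\<close> over \<open>0 < l < p\<close>: the factors of \<open>(p (a + 1))!\<close> strictly between \<open>p a\<close> and
  \<open>p (a + 1)\<close>, divided by their value \<open>(p - 1)!\<close> at \<open>a = 0\<close>.
\<close>
definition block :: "nat \<Rightarrow> rat" where
  "block a = (\<Prod>l\<in>{1..<p}. of_nat l + of_nat p * of_nat a) / fact (p - 1)"

lemma block_0 [simp]: "block 0 = 1"
  by (simp add: block_def fact_prod atLeastLessThanSuc_atLeastAtMost[symmetric] p_pos Suc_leI)

lemma p_ge_11: "p > 7 \<Longrightarrow> p \<ge> 11"
proof (rule ccontr)
  assume "p > 7" "\<not> p \<ge> 11"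
  then have "p = 8 \<or> p = 9 \<or> p = 10" by auto
  moreover have "\<not> prime (8::nat)" "\<not> prime (9::nat)" "\<not> prime (10::nat)" by simp_all
  ultimately show False using prime_p by auto
qed

text \<open>
  The coefficient of \<open>(p a)\<^sup>k\<close> in \<open>block a\<close> is \<open>e\<close> with index \<open>p - 1 - k\<close> of the numbers \<open>1, \<dots>, p - 1\<close>,
  divided by \<open>(p - 1)!\<close>. Modulo \<open>p\<^sup>2\<close> and up to a unit it is \<open>p\<close> times the Bernoulli number with index
  \<open>p - 1 - k\<close>, which is zero for odd \<open>k \<le> 5\<close>. This extra factor \<open>p\<close> is why the exponents of \<open>p\<close> are 3, 5
  and 7 for the pairs of degrees \<open>(1, 2)\<close>, \<open>(3, 4)\<close> and \<open>(5, 6)\<close>. By Wilson's theorem \<open>(p - 1)!\<close> contributes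
  a sign to the value of \<open>F\<close>.
\<close>
lemma block_expansion:
  assumes p7: "p > 7"
  obtains A B C D E F where
    "A \<in> I 0" "B \<in> I 0" "C \<in> I 0" "D \<in> I 0" "E \<in> I 0" "F \<in> I 0"
    "\<And>a. block a - (1 + of_nat p ^ 3 * (A * of_nat a + B * of_nat a ^ 2)
        + of_nat p ^ 5 * (C * of_nat a ^ 3 + D * of_nat a ^ 4)
        + of_nat p ^ 7 * (E * of_nat a ^ 5 + F * of_nat a ^ 6)) \<in> I 8"
    "7 * F + bernoulli (p - 7) \<in> I 1"
proof -
  have p11: "p \<ge> 11" using p_ge_11[OF p7] .
  let ?P = "of_nat p :: rat"
  define s where "s k = fps_nth elem_sym_fps (p - 1 - k)" for k
  define e where "e k = s k / fact (p - 1)" for k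
  have eI: "e k \<in> I n" if "s k \<in> I n" for k n
    using that p_pos unfolding e_def by (intro I_divide_fact) auto
  have s1: "s k \<in> I 1" if "k \<in> {1..8}" for k
    using elem_sym_fps_cong(1)[of "p - 2 - k"] that p11 by (simp add: s_def Suc_diff_Suc)
  have s2: "s k \<in> I 2" if "k \<in> {1, 3, 5}" for k
  proof -
    have eq: "Suc (p - 2 - k) = p - 1 - k" using that p11 by auto
    have odd: "odd (p - 1 - k)" "p - 1 - k > 1" and less: "p - 1 - k + 1 < p"
      using that p11 prime_odd_nat[OF prime_p] by auto
    have "of_nat (p - 1 - k) * s k \<in> I 2"
      using elem_sym_fps_cong(2)[of "p - 2 - k"] less unfolding eq bernoulli_odd_eq_0[OF odd] s_def by simp
    then show ?thesis
      by (rule I_cancel) (use that p11 in \<open>auto dest: dvd_imp_le\<close>)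
  qed
  have e1: "e k \<in> I 1" if "k \<in> {1..8}" for k using eI s1 that by blast
  have e2: "e k \<in> I 2" if "k \<in> {1, 3, 5}" for k using eI s2 that by blast
  have e0: "e k \<in> I 0" for k
    unfolding s_def by (intro eI) (simp add: s_def J_nth[OF elem_sym_fps_J])
  obtain A where A: "A \<in> I 0" "e 1 = ?P ^ 2 * A" using I_obtain[OF e2[of 1]] by auto
  obtain B where B: "B \<in> I 0" "e 2 = ?P ^ 1 * B" using I_obtain[OF e1[of 2]] by auto
  obtain C where C: "C \<in> I 0" "e 3 = ?P ^ 2 * C" using I_obtain[OF e2[of 3]] by auto
  obtain D where D: "D \<in> I 0" "e 4 = ?P ^ 1 * D" using I_obtain[OF e1[of 4]] by auto
  obtain E where E: "E \<in> I 0" "e 5 = ?P ^ 2 * E" using I_obtain[OF e2[of 5]] by auto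
  obtain F where F: "F \<in> I 0" "e 6 = ?P ^ 1 * F" using I_obtain[OF e1[of 6]] by auto
  have expand: "block a = (\<Sum>k\<le>p - 1. e k * (?P * of_nat a) ^ k)" for a
    unfolding block_def prod_shift_expansion by (simp add: sum_divide_distrib e_def s_def)
  have "block 0 = e 0"
    unfolding expand by (simp add: power_0_left if_distrib cong: if_cong)
  then have e_0: "e 0 = 1" by simp
  have "block a - (1 + ?P ^ 3 * (A * of_nat a + B * of_nat a ^ 2)
        + ?P ^ 5 * (C * of_nat a ^ 3 + D * of_nat a ^ 4)
        + ?P ^ 7 * (E * of_nat a ^ 5 + F * of_nat a ^ 6)) \<in> I 8" for a
  proof -
    let ?f = "\<lambda>k. e k * (?P * of_nat a) ^ k"
    have "{..p - 1} = {..6} \<union> {7..p - 1}" using p11 by auto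
    then have "block a = (\<Sum>k\<le>6. ?f k) + (\<Sum>k=7..p - 1. ?f k)"
      unfolding expand by (simp add: sum.union_disjoint)
    moreover have "(\<Sum>k\<le>6. ?f k) = 1 + ?P ^ 3 * (A * of_nat a + B * of_nat a ^ 2)
        + ?P ^ 5 * (C * of_nat a ^ 3 + D * of_nat a ^ 4)
        + ?P ^ 7 * (E * of_nat a ^ 5 + F * of_nat a ^ 6)"
    proof -
      have "{..6} = {0, 1, 2, 3, 4, 5, 6 :: nat}" by auto
      then have "(\<Sum>k\<le>6. ?f k) = ?f 0 + ?f 1 + ?f 2 + ?f 3 + ?f 4 + ?f 5 + ?f 6"
        by (simp add: add.assoc)
      also have "\<dots> = 1 + ?P ^ 3 * (A * of_nat a + B * of_nat a ^ 2)
        + ?P ^ 5 * (C * of_nat a ^ 3 + D * of_nat a ^ 4)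
        + ?P ^ 7 * (E * of_nat a ^ 5 + F * of_nat a ^ 6)"
        unfolding A B C D E F e_0 by (simp add: algebra_simps eval_nat_numeral)
      finally show ?thesis .
    qed
    moreover have "(\<Sum>k=7..p - 1. ?f k) \<in> I 8"
    proof (rule I_sum)
      fix k assume k: "k \<in> {7..p - 1}"
      have pk: "(?P * of_nat a) ^ k \<in> I k"
        unfolding power_mult_distrib by (intro I_mult_right I_p_power I_power I_of_nat)
      show "?f k \<in> I 8"
      proof (cases "k = 7")
        case True
        then show ?thesis using I_mult[OF e1[of 7] pk] by simp
      next
        case False
        then have "?f k \<in> I k" "8 \<le> k" using I_mult_left[OF e0 pk] k by auto
        then show ?thesis by (rule I_mono)
      qed
    qed
    ultimately show ?thesis by simp
  qed
  moreover have "7 * F + bernoulli (p - 7) \<in> I 1"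
  proof -
    define W where "W = (fact (p - 1) :: rat)"
    have W: "W + 1 \<in> I 1"
    proof -
      have "int p ^ 1 dvd fact (p - 1) + 1"
        using wilson_theorem[OF prime_p] by (simp add: cong_iff_dvd_diff)
      then have "of_int (fact (p - 1) + 1) \<in> I 1" by (rule I_of_int_dvd)
      then show ?thesis by (simp add: W_def)
    qed
    have W0: "W \<in> I 0" unfolding W_def using I_of_nat[of "fact (p - 1)"] by simp
    have "s 6 = W * e 6" by (simp add: e_def W_def)
    then have s6: "s 6 = ?P * F * W" unfolding F by simp
    have "odd (p - 8)" using prime_odd_nat[OF prime_p] p11 by auto
    moreover have "Suc (p - 8) = p - 7" using p11 by simp
    ultimately have "of_nat (p - 7) * s 6 + ?P * bernoulli (p - 7) \<in> I 2"
      using elem_sym_fps_cong(2)[of "p - 8"] p11 by (simp add: s_def)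
    then have "?P ^ 1 * (of_nat (p - 7) * F * W + bernoulli (p - 7)) \<in> I (1 + 1)"
      unfolding s6 one_add_one by (simp add: algebra_simps)
    then have *: "of_nat (p - 7) * F * W + bernoulli (p - 7) \<in> I 1"
      by (simp only: I_p_power_mult_iff)
    have x: "?P * (F * W) \<in> I 1"
      using I_mult[OF I_p_power[of 1] I_mult_left[OF F(1) W0]] by simp
    have y: "7 * F * (W + 1) \<in> I 1"
      by (intro I_mult_left[OF _ W] I_mult_left[OF _ F(1)] I_numeral)
    have "of_nat (p - 7) = ?P - 7" using p11 by (simp add: of_nat_diff)
    then show ?thesis using I_add[OF I_diff[OF * x] y] by (simp add: algebra_simps)
  qed
  ultimately show ?thesis using that A(1) B(1) C(1) D(1) E(1) F(1) by blast
qed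

end

section \<open>The seventh power of the finite logarithm\<close>

lemma one_minus_X_power_nth:
  "fps_nth ((1 - fps_X) ^ n :: rat fps) k = (-1) ^ k * of_nat (n choose k)"
proof (induction n arbitrary: k)
  case 0
  show ?case by (cases k) auto
next
  case (Suc n)
  show ?case
    by (cases k) (simp_all add: left_diff_distrib Suc algebra_simps)
qed

definition section_fps :: "nat \<Rightarrow> rat fps \<Rightarrow> rat fps" where
  "section_fps q g = Abs_fps (\<lambda>t. fps_nth g (t * q))"

text \<open>
  Selecting the coefficients at the multiples of \<open>q\<close> is linear over series in \<open>x\<^sup>q\<close>.
\<close>
lemma section_fps_mult_power:
  assumes "q > 0"
  shows "section_fps q ((1 - fps_X ^ q) ^ k * g) = (1 - fps_X) ^ k * section_fps q g"
proof (induction k)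
  case (Suc k)
  have step: "section_fps q ((1 - fps_X ^ q) * g) = (1 - fps_X) * section_fps q g" for g
  proof (rule fps_ext)
    fix t
    show "fps_nth (section_fps q ((1 - fps_X ^ q) * g)) t = fps_nth ((1 - fps_X) * section_fps q g) t"
      using assms
      by (cases t) (simp_all add: section_fps_def left_diff_distrib fps_X_power_mult_nth)
  qed
  show ?case
    unfolding power_Suc mult.assoc step Suc ..
qed simp

context prime_local
begin

definition pbinom :: "nat \<Rightarrow> nat \<Rightarrow> rat" where
  "pbinom v j = of_nat ((p * v) choose (p * j))"

text \<open>
  For odd \<open>p\<close> the coefficient of \<open>x\<^bsup>tp\<^esup>\<close> in \<open>(1 - x\<^sup>p - (1 - x)\<^sup>p)\<^sup>7\<close>, expanded binomially; it is congruent to \<open>p\<^sup>7\<close> times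
  the layer \<open>t\<close> modulo \<open>p\<^sup>8\<close>.
\<close>
definition layer_coeff :: "nat \<Rightarrow> rat" where
  "layer_coeff t = (-1) ^ t * (\<Sum>k\<le>7. of_nat (7 choose k) * (-1) ^ (7 - k) *
    (\<Sum>i\<le>t. of_nat (k choose i) * pbinom (7 - k) (t - i)))"

lemma nth_seventh_power:
  assumes "odd p"
  shows "fps_nth ((1 - fps_X ^ p - (1 - fps_X) ^ p) ^ 7) (t * p) = layer_coeff t"
proof -
  let ?a = "1 - fps_X ^ p :: rat fps" and ?b = "(1 - fps_X) ^ p :: rat fps"
  have sec: "fps_nth (?a ^ k * ?b ^ v) (t * p)
      = (-1) ^ t * (\<Sum>i\<le>t. of_nat (k choose i) * pbinom v (t - i))" for k v
  proof -
    have "fps_nth (?a ^ k * ?b ^ v) (t * p) = fps_nth (section_fps p (?a ^ k * ?b ^ v)) t"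
      by (simp add: section_fps_def)
    also have "\<dots> = (\<Sum>i=0..t. (-1) ^ i * of_nat (k choose i) * ((-1) ^ ((t - i) * p) * pbinom v (t - i)))"
      unfolding section_fps_mult_power[OF p_pos] fps_mult_nth
      by (simp add: one_minus_X_power_nth section_fps_def pbinom_def mult.commute flip: power_mult)
    also have "\<dots> = (\<Sum>i\<le>t. (-1) ^ t * (of_nat (k choose i) * pbinom v (t - i)))"
    proof (rule sum.cong)
      fix i assume "i \<in> {..t}"
      then have "(-1) ^ i * (-1) ^ ((t - i) * p) = ((-1) ^ t :: rat)"
        using assms by (simp add: mult.commute[of _ p] power_mult flip: power_add)
      then show "(-1) ^ i * of_nat (k choose i) * ((-1) ^ ((t - i) * p) * pbinom v (t - i))
          = (-1) ^ t * (of_nat (k choose i) * pbinom v (t - i))"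
        by (metis mult.assoc mult.commute)
    qed auto
    finally show ?thesis by (simp add: sum_distrib_left)
  qed
  have "(?a - ?b) ^ 7 = (\<Sum>k\<le>7. of_nat (7 choose k) * ?a ^ k * (- ?b) ^ (7 - k))"
    using binomial_ring[of ?a "- ?b" 7] by simp
  also have "\<dots> = (\<Sum>k\<le>7. fps_const (of_nat (7 choose k) * (-1) ^ (7 - k)) * (?a ^ k * ?b ^ (7 - k)))"
  proof (rule sum.cong)
    fix k
    have "(- ?b) ^ (7 - k) = fps_const ((-1) ^ (7 - k)) * ?b ^ (7 - k)"
      by (subst power_minus) (simp flip: fps_const_power fps_const_neg)
    then show "of_nat (7 choose k) * ?a ^ k * (- ?b) ^ (7 - k)
        = fps_const (of_nat (7 choose k) * (-1) ^ (7 - k)) * (?a ^ k * ?b ^ (7 - k))"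
      by (simp add: fps_of_nat[symmetric] algebra_simps flip: fps_const_mult)
  qed simp
  finally have "fps_nth ((?a - ?b) ^ 7) (t * p) = (\<Sum>k\<le>7. of_nat (7 choose k) * (-1) ^ (7 - k) *
      ((-1) ^ t * (\<Sum>i\<le>t. of_nat (k choose i) * pbinom (7 - k) (t - i))))"
    by (simp only: fps_sum_nth fps_mult_left_const_nth sec)
  then show ?thesis
    by (simp add: layer_coeff_def sum_distrib_left algebra_simps)
qed

lemma fact_add: "fact (m + k) = fact m * (\<Prod>l\<in>{1..<Suc k}. of_nat l + of_nat m :: rat)"
  by (induction k) (simp_all add: algebra_simps)

text \<open>
  The block of factors between \<open>p n\<close> and \<open>p (n + 1)\<close>, and then \<open>p (n + 1)\<close> itself.
\<close>
lemma fact_p_Suc: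
  "fact (p * Suc n) = fact (p * n) * fact (p - 1) * block n * of_nat p * (of_nat (Suc n) :: rat)"
proof -
  have "fact (p * Suc n) = fact (p * n + p)" by (simp add: add.commute)
  also have "\<dots> = fact (p * n) * (\<Prod>l\<in>{1..<Suc p}. of_nat l + of_nat (p * n) :: rat)"
    by (rule fact_add)
  also have "(\<Prod>l\<in>{1..<Suc p}. of_nat l + of_nat (p * n) :: rat)
      = (of_nat p + of_nat (p * n)) * (\<Prod>l\<in>{1..<p}. of_nat l + of_nat (p * n))"
    using p_pos by (simp add: Suc_leI)
  finally show ?thesis by (simp add: block_def algebra_simps)
qed

lemma block_pos: "block n > 0"
  unfolding block_def using p_pos by (intro divide_pos_pos prod_pos) (auto intro: add_pos_nonneg)

lemma pbinom_0 [simp]: "pbinom v 0 = 1" "pbinom 0 (Suc j) = 0"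
  using p_pos by (auto simp: pbinom_def)

text \<open>
  The recursion of \<open>Suc v choose Suc j\<close>, with a correction by blocks. As simplification rules this and
  the boundary values rewrite all \<open>pbinom\<close> with numeral arguments into blocks.
\<close>
lemma pbinom_Suc_Suc [simp]: "pbinom (Suc v) (Suc j) = pbinom v j * of_nat (Suc v) * block v / (of_nat (Suc j) * block j)"
proof (cases "j \<le> v")
  case True
  then have 1: "pbinom (Suc v) (Suc j) = fact (p * Suc v) / (fact (p * Suc j) * fact (p * (v - j)))"
    unfolding pbinom_def by (subst binomial_fact) (auto simp: diff_mult_distrib2)
  have 2: "pbinom v j = fact (p * v) / (fact (p * j) * fact (p * (v - j)))"
    using True unfolding pbinom_def by (subst binomial_fact) (auto simp: diff_mult_distrib2)
  show ?thesis
    unfolding 1 2 fact_p_Suc using block_pos[of v] block_pos[of j] p_pos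
    by (simp add: field_simps del: of_nat_Suc)
next
  case False
  then show ?thesis using p_pos by (simp add: pbinom_def binomial_eq_0 del: mult_Suc_right)
qed

text \<open>
  For odd \<open>p\<close> the polynomial \<open>1 - x\<^sup>p - (1 - x)\<^sup>p\<close> changes its sign if \<open>x\<^sup>n\<close> is replaced by \<open>x\<^bsup>p-n\<^esup>\<close>, and
  so its seventh power is antisymmetric as well; only three layers have to be computed.
\<close>
lemma layer_coeff_antisym: "layer_coeff 4 = - layer_coeff 3" "layer_coeff 5 = - layer_coeff 2" "layer_coeff 6 = - layer_coeff 1"
proof -
  have nonzero: "block k \<noteq> 0" for k using block_pos[of k] by simp
  show "layer_coeff 6 = - layer_coeff 1"
    unfolding layer_coeff_def using nonzero by (simp add: numeral_eq_Suc atMost_Suc field_simps)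
  show "layer_coeff 5 = - layer_coeff 2"
    unfolding layer_coeff_def using nonzero by (simp add: numeral_eq_Suc atMost_Suc field_simps)
  show "layer_coeff 4 = - layer_coeff 3"
    unfolding layer_coeff_def using nonzero by (simp add: numeral_eq_Suc atMost_Suc field_simps)
qed

text \<open>
  Finite differences of the functions \<open>block i\<close>, \<open>block i * block (i + 1)\<close> and
  \<open>block i * block (i + 1) * block (i + 2)\<close> of \<open>i\<close> at zero, of order \<open>7 - t\<close> for the layer \<open>t\<close>. The left
  factors clear the denominators \<open>block 1\<close> and \<open>block 1 * block 2\<close>.
\<close>
lemma layer_coeff_eval:
  "layer_coeff 1 = 7 * (block 6 - 6 * block 5 + 15 * block 4 - 20 * block 3 + 15 * block 2 - 6 * block 1 + block 0)"
  "block 1 * layer_coeff 2 = 21 * (2 * block 1 * (block 5 - 5 * block 4 + 10 * block 3 - 10 * block 2 + 5 * block 1 - block 0)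
    - (block 5 * block 6 - 5 * (block 4 * block 5) + 10 * (block 3 * block 4) - 10 * (block 2 * block 3) + 5 * (block 1 * block 2) - block 0 * block 1))"
  "block 1 * block 2 * layer_coeff 3 = 35 * (3 * (block 1 * block 2) * (block 4 - 4 * block 3 + 6 * block 2 - 4 * block 1 + block 0)
    - 3 * block 2 * (block 4 * block 5 - 4 * (block 3 * block 4) + 6 * (block 2 * block 3) - 4 * (block 1 * block 2) + block 0 * block 1)
    + (block 4 * block 5 * block 6 - 4 * (block 3 * block 4 * block 5) + 6 * (block 2 * block 3 * block 4) - 4 * (block 1 * block 2 * block 3)
      + block 0 * block 1 * block 2))"
proof -
  have nonzero: "block k \<noteq> 0" for k using block_pos[of k] by simp
  show "layer_coeff 1 = 7 * (block 6 - 6 * block 5 + 15 * block 4 - 20 * block 3 + 15 * block 2 - 6 * block 1 + block 0)"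
    unfolding layer_coeff_def by (simp add: numeral_eq_Suc atMost_Suc)
  show "block 1 * layer_coeff 2 = 21 * (2 * block 1 * (block 5 - 5 * block 4 + 10 * block 3 - 10 * block 2 + 5 * block 1 - block 0)
    - (block 5 * block 6 - 5 * (block 4 * block 5) + 10 * (block 3 * block 4) - 10 * (block 2 * block 3) + 5 * (block 1 * block 2) - block 0 * block 1))"
    unfolding layer_coeff_def using nonzero by (simp add: numeral_eq_Suc atMost_Suc field_simps)
  show "block 1 * block 2 * layer_coeff 3 = 35 * (3 * (block 1 * block 2) * (block 4 - 4 * block 3 + 6 * block 2 - 4 * block 1 + block 0)
    - 3 * block 2 * (block 4 * block 5 - 4 * (block 3 * block 4) + 6 * (block 2 * block 3) - 4 * (block 1 * block 2) + block 0 * block 1)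
    + (block 4 * block 5 * block 6 - 4 * (block 3 * block 4 * block 5) + 6 * (block 2 * block 3 * block 4) - 4 * (block 1 * block 2 * block 3)
      + block 0 * block 1 * block 2))"
    unfolding layer_coeff_def using nonzero by (simp add: numeral_eq_Suc atMost_Suc field_simps)
qed

section \<open>Differences of total order seven modulo the eighth power of p\<close>

lemma layer_coeff_I: "layer_coeff t \<in> I 0"
proof -
  have sgn: "(-1) ^ k \<in> I 0" for k
    by (intro I_power I_uminus I_one)
  show ?thesis
    unfolding layer_coeff_def pbinom_def by (intro I_mult_left[of _ _ 0] I_sum sgn I_of_nat)
qed

text \<open>
  Since \<open>x = u x - (u - 1) x\<close>, membership of \<open>x\<close> in \<open>I k\<close> improves to \<open>I (k + 3)\<close> until the exponent 8 of
  \<open>u x\<close> is reached.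
\<close>
lemma I_unit_cancel:
  assumes u: "u - 1 \<in> I 3" and x: "x \<in> I 0" and ux: "u * x \<in> I 8"
  shows "x \<in> I 8"
proof -
  have step: "x \<in> I (min 8 (k + 3))" if "x \<in> I k" for k
  proof -
    have "u * x \<in> I (min 8 (k + 3))" using ux by (rule I_mono) simp
    moreover have "(u - 1) * x \<in> I (min 8 (k + 3))"
      using I_mult[OF u that] by (rule I_mono) simp
    ultimately have "u * x - (u - 1) * x \<in> I (min 8 (k + 3))" by (rule I_diff)
    then show ?thesis by (simp add: algebra_simps)
  qed
  have "x \<in> I 3" using step[OF x] by simp
  then have "x \<in> I 6" using step[of 3] by simp
  then show ?thesis using step[of 6] by simp
qed

text \<open>
  Modulo \<open>p\<^sup>8\<close> a block is \<open>1 + p\<^sup>3 u + p\<^sup>5 v + p\<^sup>7 w\<close> with \<open>u\<close>, \<open>v\<close>, \<open>w\<close> of degree 2, 4, 6 in \<open>a\<close>. A product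
  of blocks has in addition the terms \<open>p\<^sup>6 u u'\<close> of degree 4. In each of the three cases the linear
  terms combine to a sixth difference of the block function, which sees only the leading coefficient
  \<open>F\<close> of \<open>w\<close>: this is the constant \<open>720 = 6!\<close>, times 7, 21 or 35. The products \<open>u u'\<close> are killed by the
  fifth difference for \<open>t = 2\<close>; for \<open>t = 3\<close> the fourth difference sees their leading coefficient, which
  occurs three times in the triple product and three times in the products of two blocks, with
  opposite signs.
\<close>
lemma layer_coeff_cong:
  assumes p7: "p > 7"
  obtains F where "F \<in> I 0" "7 * F + bernoulli (p - 7) \<in> I 1"
    "layer_coeff 1 - of_nat p ^ 7 * (5040 * F) \<in> I 8"
    "layer_coeff 2 + of_nat p ^ 7 * (15120 * F) \<in> I 8"
    "layer_coeff 3 - of_nat p ^ 7 * (25200 * F) \<in> I 8"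
proof -
  define P where "P = (of_nat p :: rat)"
  obtain A B C D E F where I0: "A \<in> I 0" "B \<in> I 0" "C \<in> I 0" "D \<in> I 0" "E \<in> I 0" "F \<in> I 0"
    and block_cong: "\<And>a. block a - (1 + of_nat p ^ 3 * (A * of_nat a + B * of_nat a ^ 2)
        + of_nat p ^ 5 * (C * of_nat a ^ 3 + D * of_nat a ^ 4)
        + of_nat p ^ 7 * (E * of_nat a ^ 5 + F * of_nat a ^ 6)) \<in> I 8"
    and FB: "7 * F + bernoulli (p - 7) \<in> I 1"
    using block_expansion[OF p7] by blast
  define u where "u a = A * of_nat a + B * of_nat a ^ 2" for a
  define v where "v a = C * of_nat a ^ 3 + D * of_nat a ^ 4" for a
  define w where "w a = E * of_nat a ^ 5 + F * of_nat a ^ 6" for a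
  \<comment> \<open>The truncations modulo \<open>p\<^sup>8\<close> of one block and of products of two and three blocks.\<close>
  define g where "g a = 1 + P ^ 3 * u a + P ^ 5 * v a + P ^ 7 * w a" for a
  define g2 where "g2 a b = 1 + P ^ 3 * (u a + u b) + P ^ 6 * (u a * u b)
      + P ^ 5 * (v a + v b) + P ^ 7 * (w a + w b)" for a b
  define g3 where "g3 a b c = 1 + P ^ 3 * (u a + u b + u c) + P ^ 6 * (u a * u b + u a * u c + u b * u c)
      + P ^ 5 * (v a + v b + v c) + P ^ 7 * (w a + w b + w c)" for a b c
  note 0 = I_add[of _ 0] I_mult_left[of _ _ 0] I_of_nat I_numeral I_power
  have PI: "P ^ k \<in> I k" for k unfolding P_def by (rule I_p_power)
  have P0: "P \<in> I 0" unfolding P_def by simp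
  have uI: "u a \<in> I 0" and vI: "v a \<in> I 0" and wI: "w a \<in> I 0" for a
    unfolding u_def v_def w_def by (intro 0 I0)+
  have gI: "g a \<in> I 0" for a
    unfolding g_def by (intro 0 P0 I_one uI vI wI)
  have cong1: "block a - g a \<in> I 8" for a
    using block_cong[of a] by (simp add: g_def u_def v_def w_def P_def)
  have block_I: "block a \<in> I 0" for a
    using I_cong[OF I_mono[OF cong1]] gI by blast
  have cong2: "block a * block b - g2 a b \<in> I 8" for a b
  proof -
    have "block a * block b - g2 a b = block a * (block b - g b) + (block a - g a) * g b
      + P ^ 8 * (u a * v b + v a * u b + P ^ 2 * (u a * w b + w a * u b + v a * v b)
        + P ^ 4 * (v a * w b + w a * v b) + P ^ 6 * (w a * w b))"
      by (simp add: g_def g2_def algebra_simps flip: power_add)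
    also have "\<dots> \<in> I 8"
      by (intro I_add[of _ 8] I_mult_left[OF block_I cong1] I_mult_right[OF cong1 gI] I_mult_right[OF PI])
        (intro 0 uI vI wI P0)+
    finally show ?thesis .
  qed
  have cong3: "block a * block b * block c - g3 a b c \<in> I 8" for a b c
  proof -
    have g2I: "g2 a b \<in> I 0"
      unfolding g2_def by (intro 0 P0 I_one uI vI wI)
    have "block a * block b * block c - g3 a b c = (block a * block b) * (block c - g c) + (block a * block b - g2 a b) * g c
      + P ^ 8 * ((u a + u b) * v c + (v a + v b) * u c
        + P * (u a * u b * u c)
        + P ^ 2 * ((u a + u b) * w c + (w a + w b) * u c + (v a + v b) * v c)
        + P ^ 3 * (u a * u b * v c) + P ^ 4 * ((v a + v b) * w c + (w a + w b) * v c)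
        + P ^ 5 * (u a * u b * w c) + P ^ 6 * ((w a + w b) * w c))"
      by (simp add: g_def g2_def g3_def algebra_simps flip: power_add power_Suc power_Suc2)
    also have "\<dots> \<in> I 8"
      by (intro I_add[of _ 8] I_mult_left[OF _ cong1] I_mult_right[OF cong2 gI] I_mult_right[OF PI])
        (intro 0 uI vI wI P0 block_I)+
    finally show ?thesis .
  qed
  have block_minus_1: "block a - 1 \<in> I 3" for a
  proof -
    have "block a - 1 = (block a - g a) + P ^ 3 * (u a + P ^ 2 * v a + P ^ 4 * w a)"
      by (simp add: g_def algebra_simps flip: power_add)
    also have "\<dots> \<in> I 3"
      by (intro I_add[of _ 3] I_mono[OF cong1] I_mult_right[OF PI])
        (simp, (intro 0 uI vI wI P0)+)
    finally show ?thesis .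
  qed
  have P7F: "P ^ 7 * x \<in> I 7" if "x \<in> I 0" for x using that by (intro I_mult_right[OF PI])
  note 8 = I_add[of _ 8] I_diff[of _ 8] I_mult_left[OF I_numeral, of _ 8] cong1 cong2 cong3

  have "layer_coeff 1 - P ^ 7 * (5040 * F) = 7 * ((block 6 - g 6) - 6 * (block 5 - g 5) + 15 * (block 4 - g 4)
      - 20 * (block 3 - g 3) + 15 * (block 2 - g 2) - 6 * (block 1 - g 1) + (block 0 - g 0))"
    unfolding layer_coeff_eval g_def u_def v_def w_def by (simp add: algebra_simps)
  also have "\<dots> \<in> I 8" by (intro 8)
  finally have Z1: "layer_coeff 1 - P ^ 7 * (5040 * F) \<in> I 8" .

  have Z2: "layer_coeff 2 + P ^ 7 * (15120 * F) \<in> I 8"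
  proof -
    \<comment> \<open>The constants below are values of differences: the fifth difference of \<open>x\<^sup>5\<close> is 120, that of
      \<open>x\<^sup>6\<close> is 1800 at 0 and 2520 at 1.\<close>
    define S where "S = block 5 - 5 * block 4 + 10 * block 3 - 10 * block 2 + 5 * block 1 - block 0"
    define S2 where "S2 = block 5 * block 6 - 5 * (block 4 * block 5) + 10 * (block 3 * block 4) - 10 * (block 2 * block 3)
      + 5 * (block 1 * block 2) - block 0 * block 1"
    have "S - P ^ 7 * (120 * E + 1800 * F) = (block 5 - g 5) - 5 * (block 4 - g 4) + 10 * (block 3 - g 3)
        - 10 * (block 2 - g 2) + 5 * (block 1 - g 1) - (block 0 - g 0)"
      unfolding S_def g_def u_def v_def w_def by (simp add: algebra_simps)
    also have "\<dots> \<in> I 8" by (intro 8)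
    finally have S: "S - P ^ 7 * (120 * E + 1800 * F) \<in> I 8" .
    have "S2 - P ^ 7 * (240 * E + 4320 * F) = (block 5 * block 6 - g2 5 6) - 5 * (block 4 * block 5 - g2 4 5)
        + 10 * (block 3 * block 4 - g2 3 4) - 10 * (block 2 * block 3 - g2 2 3) + 5 * (block 1 * block 2 - g2 1 2) - (block 0 * block 1 - g2 0 1)"
      unfolding S2_def g2_def u_def v_def w_def by (simp add: algebra_simps)
    also have "\<dots> \<in> I 8" by (intro 8)
    finally have S2: "S2 - P ^ 7 * (240 * E + 4320 * F) \<in> I 8" .
    have "P ^ 7 * (120 * E + 1800 * F) \<in> I 7"
      by (rule P7F) (intro 0 I0)
    then have S7: "S \<in> I 7"
      using I_cong[OF I_mono[OF S, of 7]] by simp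
    have "block 1 * (layer_coeff 2 + P ^ 7 * (15120 * F)) = 21 * (2 * ((block 1 - 1) * S)
        + 2 * (S - P ^ 7 * (120 * E + 1800 * F)) - (S2 - P ^ 7 * (240 * E + 4320 * F)))
        + (block 1 - 1) * (P ^ 7 * (15120 * F))"
      unfolding distrib_left layer_coeff_eval S_def[symmetric] S2_def[symmetric] by (simp add: algebra_simps)
    also have "\<dots> \<in> I 8"
      by (intro 8 S S2 I_mono[OF I_mult[OF block_minus_1 S7]] I_mono[OF I_mult[OF block_minus_1 P7F]]) (simp, intro 0 I0, simp)
    finally show ?thesis
      by (rule I_unit_cancel[OF block_minus_1, rotated]) (intro 0 layer_coeff_I I0 P0)
  qed

  have Z3: "layer_coeff 3 - P ^ 7 * (25200 * F) \<in> I 8"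
  proof -
    define S where "S = block 4 - 4 * block 3 + 6 * block 2 - 4 * block 1 + block 0"
    define S2 where "S2 = block 4 * block 5 - 4 * (block 3 * block 4) + 6 * (block 2 * block 3) - 4 * (block 1 * block 2) + block 0 * block 1"
    define S3 where "S3 = block 4 * block 5 * block 6 - 4 * (block 3 * block 4 * block 5) + 6 * (block 2 * block 3 * block 4)
      - 4 * (block 1 * block 2 * block 3) + block 0 * block 1 * block 2"
    \<comment> \<open>The fourth difference of \<open>x\<^sup>4\<close> is 24, that of \<open>x\<^sup>5\<close> is 240 at 0 and 360 at 1, and that of \<open>x\<^sup>6\<close>
      is 1560 at 0 and 3360 at 1.\<close>
    define s where "s = 24 * D + P ^ 2 * (240 * E + 1560 * F)"
    define s2 where "s2 = 48 * D + P * (24 * B ^ 2) + P ^ 2 * (600 * E + 4920 * F)"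
    have "S - P ^ 5 * s = (block 4 - g 4) - 4 * (block 3 - g 3)
        + 6 * (block 2 - g 2) - 4 * (block 1 - g 1) + (block 0 - g 0)"
      unfolding S_def s_def g_def u_def v_def w_def by (simp add: algebra_simps flip: power_add)
    also have "\<dots> \<in> I 8" by (intro 8)
    finally have S: "S - P ^ 5 * s \<in> I 8" .
    have "S2 - P ^ 5 * s2 = (block 4 * block 5 - g2 4 5)
        - 4 * (block 3 * block 4 - g2 3 4) + 6 * (block 2 * block 3 - g2 2 3) - 4 * (block 1 * block 2 - g2 1 2) + (block 0 * block 1 - g2 0 1)"
      unfolding S2_def s2_def g2_def u_def v_def w_def
      by (simp add: algebra_simps power2_eq_square[of B] flip: power_add power_Suc power_Suc2)
    also have "\<dots> \<in> I 8" by (intro 8)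
    finally have S2: "S2 - P ^ 5 * s2 \<in> I 8" .
    have s: "s \<in> I 0" "s2 \<in> I 0"
      unfolding s_def s2_def by (intro 0 I0 P0)+
    have S5: "S \<in> I 5" "S2 \<in> I 5"
      using I_cong[OF I_mono[OF S, of 5]] I_cong[OF I_mono[OF S2, of 5]]
        I_mult_right[OF PI s(1), of 5] I_mult_right[OF PI s(2), of 5] by simp_all
    have "3 * S - 3 * S2 + S3 - P ^ 7 * (720 * F) =
        3 * ((block 4 - g 4) - 4 * (block 3 - g 3) + 6 * (block 2 - g 2) - 4 * (block 1 - g 1) + (block 0 - g 0))
        - 3 * ((block 4 * block 5 - g2 4 5) - 4 * (block 3 * block 4 - g2 3 4) + 6 * (block 2 * block 3 - g2 2 3)
          - 4 * (block 1 * block 2 - g2 1 2) + (block 0 * block 1 - g2 0 1))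
        + ((block 4 * block 5 * block 6 - g3 4 5 6) - 4 * (block 3 * block 4 * block 5 - g3 3 4 5)
          + 6 * (block 2 * block 3 * block 4 - g3 2 3 4) - 4 * (block 1 * block 2 * block 3 - g3 1 2 3) + (block 0 * block 1 * block 2 - g3 0 1 2))"
      unfolding S_def S2_def S3_def g_def g2_def g3_def u_def v_def w_def by (simp add: algebra_simps)
    also have "\<dots> \<in> I 8" by (intro 8)
    finally have S123: "3 * S - 3 * S2 + S3 - P ^ 7 * (720 * F) \<in> I 8" .
    have block_block_minus_1: "block 1 * block 2 - 1 \<in> I 3"
    proof -
      have "block 1 * block 2 - 1 = (block 1 - 1) * block 2 + (block 2 - 1)" by (simp add: algebra_simps)
      also have "\<dots> \<in> I 3" by (intro I_add I_mult_right block_minus_1 block_I)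
      finally show ?thesis .
    qed
    have "(block 1 * block 2) * (layer_coeff 3 - P ^ 7 * (25200 * F)) = 35 * (3 * ((block 1 * block 2 - 1) * S)
        - 3 * ((block 2 - 1) * S2) + (3 * S - 3 * S2 + S3 - P ^ 7 * (720 * F)))
        - (block 1 * block 2 - 1) * (P ^ 7 * (25200 * F))"
      unfolding right_diff_distrib[of "block 1 * block 2"] layer_coeff_eval S_def[symmetric] S2_def[symmetric] S3_def[symmetric]
      by (simp add: algebra_simps)
    also have "\<dots> \<in> I 8"
      by (intro 8 S123 I_mono[OF I_mult[OF block_block_minus_1 S5(1)]] I_mono[OF I_mult[OF block_minus_1 S5(2)]]
          I_mono[OF I_mult[OF block_block_minus_1 P7F]]) (simp, simp, intro 0 I0, simp)
    finally show ?thesis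
      by (rule I_unit_cancel[OF block_block_minus_1, rotated]) (intro I_diff[of _ 0] 0 layer_coeff_I I0 P0)
  qed
  show ?thesis
    using that[OF I0(6) FB] Z1 Z2 Z3 unfolding P_def by blast
qed

text \<open>
  Pascal's rule, as \<open>p\<close> divides \<open>p choose Suc k\<close>.
\<close>
section \<open>The layers modulo p\<close>

lemma choose_pred_cong:
  "k < p \<Longrightarrow> of_nat ((p - 1) choose k) - (-1) ^ k \<in> I 1"
proof (induction k)
  case (Suc k)
  have "p choose Suc k = ((p - 1) choose k) + ((p - 1) choose Suc k)"
    using p_pos by (cases p) simp_all
  then have "of_nat ((p - 1) choose Suc k) - (-1) ^ Suc k
      = of_nat (p choose Suc k) - (of_nat ((p - 1) choose k) - (-1 :: rat) ^ k)"
    by simp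
  moreover have "of_nat (p choose Suc k) \<in> I 1"
    using Suc.prems prime_p p_pos by (intro I_of_nat_dvd) (simp add: dvd_choose_prime)
  ultimately show ?case using Suc by (simp only: I_diff Suc_lessD)
qed simp

text \<open>
  For odd \<open>p\<close> a lift with \<open>p\<close>-integral coefficients of the finite logarithm \<open>\<Sum> x\<^sup>c / c\<close> over \<open>0 < c < p\<close>.
\<close>
definition finite_log :: "rat fps" where
  "finite_log = fps_const (1 / of_nat p) * (1 - fps_X ^ p - (1 - fps_X) ^ p)"

lemma layer_fps_cong_finite_log:
  assumes "odd p"
  shows "layer_fps p 1 - finite_log \<in> J 1"
  unfolding J_def
proof (intro CollectI allI)
  fix n
  have nth: "fps_nth finite_log n = ((if n = 0 then 1 else 0) - (if n = p then 1 else 0)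
      - (-1) ^ n * of_nat (p choose n)) / of_nat p"
    by (simp add: finite_log_def one_minus_X_power_nth)
  consider "n = 0" | "n = p" | "n > p" | m where "n = Suc m" "Suc m < p"
    using p_pos by (cases n) force+
  then show "fps_nth (layer_fps p 1 - finite_log) n \<in> I 1"
  proof cases
    case 4
    have "of_nat (Suc m) * of_nat (p choose Suc m) = (of_nat p * of_nat ((p - 1) choose m) :: rat)"
      using Suc_times_binomial_eq[of "p - 1" m] p_pos
      by (simp add: mult.commute del: of_nat_Suc flip: of_nat_mult)
    then have "(of_nat (p choose Suc m) :: rat) / of_nat p = of_nat ((p - 1) choose m) / of_nat (Suc m)"
      using p_pos by (simp add: field_simps del: of_nat_Suc)
    moreover have "fps_nth finite_log n = (-1) ^ m * (of_nat (p choose Suc m) / of_nat p)"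
      using 4 unfolding nth by simp
    moreover have "fps_nth (layer_fps p 1) n = 1 / of_nat (Suc m)"
      using 4 by (simp add: layer_fps_def nat_dvd_not_less del: of_nat_Suc)
    ultimately have "fps_nth (layer_fps p 1 - finite_log) n
        = 1 / of_nat (Suc m) - (-1) ^ m * (of_nat ((p - 1) choose m) / of_nat (Suc m))"
      by (simp only: fps_sub_nth)
    also have "\<dots> = - (1 / of_nat (Suc m)) * ((-1) ^ m * (of_nat ((p - 1) choose m) - (-1) ^ m))"
      by (simp add: algebra_simps diff_divide_distrib del: of_nat_Suc flip: power_add mult_2)
    finally have eq: "fps_nth (layer_fps p 1 - finite_log) n
        = - (1 / of_nat (Suc m)) * ((-1) ^ m * (of_nat ((p - 1) choose m) - (-1) ^ m))" .
    have "\<not> p dvd Suc m" using 4 by (auto dest: dvd_imp_le)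
    moreover have "(-1) ^ m * (of_nat ((p - 1) choose m) - (-1) ^ m) \<in> I 1"
      using choose_pred_cong[of m] 4 by (intro I_mult_left I_power I_uminus I_one) auto
    ultimately show ?thesis
      unfolding eq by (rule I_mult_left[OF I_uminus[OF I_inverse_of_nat]])
  next
    case 1
    then show ?thesis using p_pos unfolding fps_sub_nth nth by (simp add: layer_fps_def)
  next
    case 2
    then show ?thesis using assms p_pos unfolding fps_sub_nth nth by (simp add: layer_fps_def)
  next
    case 3
    then show ?thesis unfolding fps_sub_nth nth by (simp add: layer_fps_def binomial_eq_0)
  qed
qed

text \<open>
  The layers are congruent to \<open>-720 B\<close> times \<open>1, -3, 5, -5, 3, -1\<close>, that is to
  \<open>(-1)\<^bsup>t-1\<^esup> (7 choose t) T\<^sub>1 / 7\<close>. These are the weights of the polynomial \<open>-(504 M + 210 M\<^sup>3 + 6 M\<^sup>5) B\<close>.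
\<close>
lemma base_layers:
  assumes p7: "p > 7" and t: "t \<in> {1..6}"
  defines "B \<equiv> bernoulli (p - 7)"
  shows "fps_nth (layer_fps p 1 ^ 7) (t * p)
    - eulerian_weight (- 504 * B) (- 210 * B) (- 6 * B) t \<in> I 1"
proof -
  have odd: "odd p" using prime_odd_nat[OF prime_p] p7 by auto
  let ?P = "of_nat p :: rat"
  let ?w = "eulerian_weight (- 504 * B) (- 210 * B) (- 6 * B)"
  obtain F where F: "F \<in> I 0" "7 * F + B \<in> I 1" and Z:
    "layer_coeff 1 - of_nat p ^ 7 * (5040 * F) \<in> I 8"
    "layer_coeff 2 + of_nat p ^ 7 * (15120 * F) \<in> I 8"
    "layer_coeff 3 - of_nat p ^ 7 * (25200 * F) \<in> I 8"
    using layer_coeff_cong[OF p7] unfolding B_def .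
  have "?P ^ 7 * (7 * F + B) \<in> I 8"
    using I_p_power_mult[OF F(2), of 7] by simp
  then have FB: "numeral n * (?P ^ 7 * (7 * F + B)) \<in> I 8" for n
    by (rule I_mult_left[OF I_numeral])
  \<comment> \<open>Replaces \<open>F\<close> by \<open>-B / 7\<close> in the three congruences.\<close>
  have fb: "720 * (?P ^ 7 * (7 * F + B)) \<in> I 8" "2160 * (?P ^ 7 * (7 * F + B)) \<in> I 8"
    "3600 * (?P ^ 7 * (7 * F + B)) \<in> I 8" by (rule FB)+
  have w: "layer_coeff 1 - ?P ^ 7 * ?w 1 \<in> I 8" "layer_coeff 2 - ?P ^ 7 * ?w 2 \<in> I 8" "layer_coeff 3 - ?P ^ 7 * ?w 3 \<in> I 8"
    using I_add[OF Z(1) fb(1)] I_diff[OF Z(2) fb(2)] I_add[OF Z(3) fb(3)]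
    by (simp_all add: algebra_simps)
  have "t = 1 \<or> t = 2 \<or> t = 3 \<or> t = 4 \<or> t = 5 \<or> t = 6" using t by auto
  then have w: "layer_coeff t - ?P ^ 7 * ?w t \<in> I (7 + 1)"
    using w I_uminus[OF w(1)] I_uminus[OF w(2)] I_uminus[OF w(3)] layer_coeff_antisym
    by (elim disjE) (simp_all add: algebra_simps)
  have KJ: "finite_log \<in> J 0"
    unfolding J_def
  proof (intro CollectI allI)
    fix n
    show "fps_nth finite_log n \<in> I 0"
      using I_diff[OF J_nth[OF layer_fps_J[of p 1], of n] I_mono[OF J_nth[OF layer_fps_cong_finite_log[OF odd], of n], of 0]]
      by simp
  qed
  have "fps_const ?P * finite_log = 1 - fps_X ^ p - (1 - fps_X) ^ p"
    using p_pos by (simp add: finite_log_def flip: mult.assoc)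
  then have "fps_const (?P ^ 7) * finite_log ^ 7 = (1 - fps_X ^ p - (1 - fps_X) ^ p) ^ 7"
    by (metis fps_const_power power_mult_distrib)
  then have "?P ^ 7 * fps_nth (finite_log ^ 7) (t * p) = layer_coeff t"
    using nth_seventh_power[OF odd, of t] by (metis fps_mult_left_const_nth)
  then have "?P ^ 7 * (fps_nth (finite_log ^ 7) (t * p) - ?w t) \<in> I (7 + 1)"
    using w by (simp only: right_diff_distrib)
  then have x: "fps_nth (finite_log ^ 7) (t * p) - ?w t \<in> I 1"
    by (simp only: I_p_power_mult_iff)
  have "fps_nth (layer_fps p 1 ^ 7 - finite_log ^ 7) (t * p) \<in> I 1"
    by (intro J_nth J_power_cong layer_fps_J KJ layer_fps_cong_finite_log odd)
  then show ?thesis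
    unfolding fps_sub_nth by (rule I_trans[OF _ x])
qed

end

theorem theorem1p1:
  fixes r m p :: nat
  assumes "r > 0" and "m > 0" and "prime p" and "p > 7" and "\<not> p dvd m"
  shows "(r = 1 \<longrightarrow>
           rat_cong p 1 (multiple_harmonic_sum 7 p (m * p))
             (- (504 * of_nat m + 210 * of_nat m ^ 3 + 6 * of_nat m ^ 5) * bernoulli (p - 7)))
       \<and> (r \<ge> 2 \<longrightarrow>
           rat_cong p r (multiple_harmonic_sum 7 p (m * p ^ r))
             (- (fact 7 / 10) * of_nat m * of_nat p ^ (r - 1) * bernoulli (p - 7)))"
proof -
  interpret prime_local p by unfold_locales fact
  define B where "B = bernoulli (p - 7)"
  have BI: "B \<in> I 0" unfolding B_def using \<open>p > 7\<close> by (intro bernoulli_I) simp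
  let ?a = "- 504 * B" and ?b = "- 210 * B" and ?c = "- 6 * B"
  have main: "multiple_harmonic_sum 7 p (m * p ^ Suc n) - (?a * of_nat (p ^ n * m)
      + ?b * of_nat (p ^ n * m) ^ 3 + ?c * of_nat (p ^ n * m) ^ 5) \<in> I (Suc n)" for n
    using base_layers[OF \<open>p > 7\<close>] unfolding B_def by (intro harmonic_sum_induction \<open>p > 7\<close>)
  show ?thesis
  proof (intro conjI impI)
    show "rat_cong p 1 (multiple_harmonic_sum 7 p (m * p))
        (- (504 * of_nat m + 210 * of_nat m ^ 3 + 6 * of_nat m ^ 5) * bernoulli (p - 7))"
      using main[of 0] unfolding rat_cong_iff B_def by (simp add: algebra_simps)
  next
    assume "r \<ge> 2"
    then obtain n where n: "r = Suc n" "n \<ge> 1" by (cases r) auto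
    \<comment> \<open>The cube and the fifth power of \<open>?x\<close> are divisible by \<open>p\<^sup>r\<close>, since \<open>2 (r - 1) \<ge> r\<close>.\<close>
    let ?x = "of_nat (p ^ n * m) :: rat"
    have x: "?x ^ k \<in> I r" if "k \<ge> 2" for k
    proof -
      have "?x ^ k = of_nat p ^ (n * k) * of_nat m ^ k"
        by (simp add: power_mult_distrib power_mult)
      also have "\<dots> \<in> I (n * k)" by (intro I_mult_right I_p_power I_power I_of_nat)
      finally show ?thesis
      proof (rule I_mono)
        have "r \<le> n * 2" using n by simp
        also have "\<dots> \<le> n * k" using that by simp
        finally show "r \<le> n * k" .
      qed
    qed
    have b: "?b * ?x ^ 3 + ?c * ?x ^ 5 \<in> I r"
      by (intro I_add I_mult_left x I_mult_left[of _ B 0] BI I_uminus I_numeral) simp_all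
    have "multiple_harmonic_sum 7 p (m * p ^ r) - ?a * ?x \<in> I r"
      using I_add[OF main[of n, folded n(1)] b] by (simp add: algebra_simps)
    moreover have "?a * ?x = - (fact 7 / 10) * of_nat m * of_nat p ^ (r - 1) * bernoulli (p - 7)"
      by (simp add: B_def n(1) fact_numeral)
    ultimately show "rat_cong p r (multiple_harmonic_sum 7 p (m * p ^ r))
        (- (fact 7 / 10) * of_nat m * of_nat p ^ (r - 1) * bernoulli (p - 7))"
      by (simp only: rat_cong_iff)
  qed
qed

end
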